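(* There is a polynomial time $3$-approximation algorithm for the robust multiple-knapsack center problem when the number $d$ of weight functions is a constant and all but possibly one of the weight functions are poly-bounded.
   Context: Robust multiple-knapsack center problem: given a finite metric space $(X,\mathrm{dist})$, weight functions $w_1,\dots,w_d:X\to\mathbb{Z}_{\ge0}$ with budgets $k_1,\dots,k_d$, and an integer $m\in\{0,\dots,|X|\}$, find $S\subseteq X$ with $\sum_{v\in S}w_i(v)\le k_i$ for all $i=1,\dots,d$, minimizing $\min_{T\subseteq X,|T|=m}\max_{v\in T}\mathrm{dist}(v,S)$, where $\mathrm{dist}(v,S)=\min_{u\in S}\mathrm{dist}(v,u)$. With optimum value $\mathrm{OPT}$, a $3$-approximation returns a feasible $S$ such that at least $m$ points $v\in X$ have $\mathrm{dist}(v,S)\le3\,\mathrm{OPT}$. A weight function is poly-bounded if its values are bounded by a polynomial in $|X|$. *)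

theory Defs
  imports "HOL-Analysis.Analysis" "HOL-Computational_Algebra.Polynomial" "HOL-Library.Log_Nat"
begin

section \<open>Model of computation\<close>

text \<open>
  The libraries contain no machine model, so polynomial time is taken with respect to a
  deterministic language of while programs over binary trees with natural numbers at the leaves.
  Numbers count by the length of their binary representation, and every step is charged
  at least the size of what it reads and what it writes (logarithmic cost).
  Each primitive is computable in polynomial time on a Turing machine and the size of the output
  is bounded by the cost, so up to polynomial factors this is Turing machine time.
\<close>

datatype data = Num nat | Cell data data

fun bits :: "data \<Rightarrow> nat" where
  "bits (Num n) = 1 + floorlog 2 n"
| "bits (Cell a b) = 1 + bits a + bits b"

datatype prim = Ident | First | Second | IsNum | Plus | Monus | Times | Quot | Less

text \<open>Primitives are total: an argument of the wrong shape yields \<^term>\<open>Num 0\<close>.\<close>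

fun arith :: "(nat \<Rightarrow> nat \<Rightarrow> nat) \<Rightarrow> data \<Rightarrow> data" where
  "arith f (Cell (Num a) (Num b)) = Num (f a b)"
| "arith f _ = Num 0"

fun apply_prim :: "prim \<Rightarrow> data \<Rightarrow> data" where
  "apply_prim Ident x = x"
| "apply_prim First x = (case x of Cell a b \<Rightarrow> a | Num _ \<Rightarrow> Num 0)"
| "apply_prim Second x = (case x of Cell a b \<Rightarrow> b | Num _ \<Rightarrow> Num 0)"
| "apply_prim IsNum x = (case x of Cell a b \<Rightarrow> Num 0 | Num _ \<Rightarrow> Num 1)"
| "apply_prim Plus x = arith (+) x"
| "apply_prim Monus x = arith (-) x"
| "apply_prim Times x = arith (*) x"
| "apply_prim Quot x = arith (div) x"
| "apply_prim Less x = arith (\<lambda>a b. if a < b then 1 else 0) x"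

text \<open>
  A program denotes a partial function on \<^typ>\<open>data\<close>. \<open>Both p q\<close> runs \<open>p\<close> and \<open>q\<close> on the same
  argument and pairs the results; \<open>While b p\<close> iterates \<open>p\<close> as long as the value of \<open>b\<close> on the
  current argument differs from \<^term>\<open>Num 0\<close>.
\<close>

datatype prog =
    Const data
  | Prim prim
  | Seq prog prog
  | Both prog prog
  | Cond prog prog prog
  | While prog prog

text \<open>\<open>runs p x y t\<close>: on argument \<open>x\<close> the program \<open>p\<close> halts with result \<open>y\<close> at cost \<open>t\<close>.\<close>

inductive runs :: "prog \<Rightarrow> data \<Rightarrow> data \<Rightarrow> nat \<Rightarrow> bool" where
  Const: "runs (Const c) x c (bits x + bits c)"
| Prim: "runs (Prim f) x (apply_prim f x) (bits x + bits (apply_prim f x))"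
| Seq: "runs p x y s \<Longrightarrow> runs q y z t \<Longrightarrow> runs (Seq p q) x z (s + t + 1)"
| Both: "runs p x y s \<Longrightarrow> runs q x z t \<Longrightarrow>
    runs (Both p q) x (Cell y z) (s + t + bits x + bits (Cell y z))"
| CondT: "runs b x c s \<Longrightarrow> c \<noteq> Num 0 \<Longrightarrow> runs p x y t \<Longrightarrow>
    runs (Cond b p q) x y (s + t + bits x)"
| CondF: "runs b x (Num 0) s \<Longrightarrow> runs q x y t \<Longrightarrow> runs (Cond b p q) x y (s + t + bits x)"
| WhileF: "runs b x (Num 0) s \<Longrightarrow> runs (While b p) x x (s + bits x)"
| WhileT: "runs b x c s \<Longrightarrow> c \<noteq> Num 0 \<Longrightarrow> runs p x y t \<Longrightarrow> runs (While b p) y z u \<Longrightarrow>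
    runs (While b p) x z (s + t + u + bits x)"

inductive_cases runs_ConstE: "runs (Const c) x y t"
inductive_cases runs_PrimE: "runs (Prim f) x y t"
inductive_cases runs_SeqE: "runs (Seq p q) x y t"
inductive_cases runs_BothE: "runs (Both p q) x y t"
inductive_cases runs_CondE: "runs (Cond b p q) x y t"
inductive_cases runs_WhileE: "runs (While b p) x y t"

lemma runs_deterministic: "runs p x y t \<Longrightarrow> runs p x y' t' \<Longrightarrow> y' = y \<and> t' = t"
proof (induction arbitrary: y' t' rule: runs.induct)
  case Const then show ?case by (auto elim: runs_ConstE)
next
  case Prim then show ?case by (auto elim: runs_PrimE)
next
  case Seq from Seq.prems show ?case by (rule runs_SeqE) (auto dest!: Seq.IH)
next
  case Both from Both.prems show ?case by (rule runs_BothE) (auto dest!: Both.IH)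
next
  case CondT from CondT.prems show ?case
    by (rule runs_CondE) (use CondT.hyps in \<open>auto dest!: CondT.IH\<close>)+
next
  case CondF from CondF.prems show ?case
    by (rule runs_CondE) (auto dest!: CondF.IH)+
next
  case WhileF from WhileF.prems show ?case
    by (rule runs_WhileE) (auto dest!: WhileF.IH)+
next
  case WhileT from WhileT.prems show ?case
    by (rule runs_WhileE) (use WhileT.hyps in \<open>auto dest!: WhileT.IH\<close>)+
qed

lemma bits_result_le_cost: "runs p x y t \<Longrightarrow> bits y \<le> t"
  by (induction rule: runs.induct) auto


section \<open>The robust multiple-knapsack center problem\<close>

text \<open>
  The points are numbered, \<open>X = {..<npoints I}\<close>, and so are the weight functions. Distances are
  rational so that instances have a finite encoding. Only values at indices in range are meaningful.
\<close>

record rmkc =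
  npoints :: nat
  distance :: "nat \<Rightarrow> nat \<Rightarrow> rat"
  nweights :: nat
  weight :: "nat \<Rightarrow> nat \<Rightarrow> nat"
  budget :: "nat \<Rightarrow> nat"
  quota :: nat

abbreviation points :: "rmkc \<Rightarrow> nat set" where
  "points I \<equiv> {..<npoints I}"

text \<open>
  \<^locale>\<open>Metric_space\<close> asks for nonnegativity and symmetry off the carrier as well. This is no
  restriction: neither the problem nor the encoding below looks at those values.
\<close>

definition valid_rmkc :: "rmkc \<Rightarrow> bool" where
  "valid_rmkc I \<longleftrightarrow>
     Metric_space (points I) (\<lambda>u v. real_of_rat (distance I u v)) \<and> quota I \<le> npoints I"

definition feasible :: "rmkc \<Rightarrow> nat set \<Rightarrow> bool" where
  "feasible I S \<longleftrightarrow>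
     S \<subseteq> points I \<and> (\<forall>i<nweights I. (\<Sum>v\<in>S. weight I i v) \<le> budget I i)"

text \<open>
  All minima and maxima range over finite sets and are therefore written as infima and suprema
  in \<^typ>\<open>ennreal\<close>. This fixes the degenerate cases: every point has distance \<open>\<infinity>\<close> to the
  empty set, and the maximum over \<open>T = {}\<close> is \<open>0\<close>.
\<close>

definition dist_to_set :: "rmkc \<Rightarrow> nat \<Rightarrow> nat set \<Rightarrow> ennreal" where
  "dist_to_set I v S = (INF u\<in>S. ennreal (real_of_rat (distance I v u)))"

definition objective :: "rmkc \<Rightarrow> nat set \<Rightarrow> ennreal" where
  "objective I S =
     (INF T\<in>{T. T \<subseteq> points I \<and> card T = quota I}. SUP v\<in>T. dist_to_set I v S)"

definition OPT :: "rmkc \<Rightarrow> ennreal" where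
  "OPT I = (INF S\<in>{S. feasible I S}. objective I S)"

definition approx_solution :: "ennreal \<Rightarrow> rmkc \<Rightarrow> nat set \<Rightarrow> bool" where
  "approx_solution \<alpha> I S \<longleftrightarrow>
     feasible I S \<and> quota I \<le> card {v \<in> points I. dist_to_set I v S \<le> \<alpha> * OPT I}"


section \<open>Encoding of instances and solutions\<close>

fun encode_list :: "('a \<Rightarrow> data) \<Rightarrow> 'a list \<Rightarrow> data" where
  "encode_list e [] = Num 0"
| "encode_list e (x # xs) = Cell (e x) (encode_list e xs)"

text \<open>A nonnegative rational is given by numerator and denominator in lowest terms.\<close>

definition encode_rat :: "rat \<Rightarrow> data" where
  "encode_rat r = (case quotient_of r of (a, b) \<Rightarrow> Cell (Num (nat a)) (Num (nat b)))"

definition encode_rmkc :: "rmkc \<Rightarrow> data" where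
  "encode_rmkc I = encode_list id
     [Num (npoints I),
      encode_list (\<lambda>u. encode_list (\<lambda>v. encode_rat (distance I u v)) [0..<npoints I]) [0..<npoints I],
      Num (nweights I),
      encode_list (\<lambda>i. encode_list (\<lambda>v. Num (weight I i v)) [0..<npoints I]) [0..<nweights I],
      encode_list (\<lambda>i. Num (budget I i)) [0..<nweights I],
      Num (quota I)]"


section \<open>Polynomial-time approximation algorithms\<close>

text \<open>
  \<open>poly_time_approx \<alpha> C A\<close>: on the instances in the class \<open>C\<close>, the program \<open>A\<close> is a
  polynomial-time \<open>\<alpha>\<close>-approximation algorithm. The returned set is listed in any order.
\<close>

definition poly_time_approx :: "ennreal \<Rightarrow> rmkc set \<Rightarrow> prog \<Rightarrow> bool" where
  "poly_time_approx \<alpha> C A \<longleftrightarrow>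
     (\<exists>q :: nat poly. \<forall>I\<in>C. \<exists>xs t.
        runs A (encode_rmkc I) (encode_list Num xs) t \<and>
        t \<le> poly q (bits (encode_rmkc I)) \<and>
        approx_solution \<alpha> I (set xs))"

definition weight_bounded_by :: "nat poly \<Rightarrow> rmkc \<Rightarrow> nat \<Rightarrow> bool" where
  "weight_bounded_by p I i \<longleftrightarrow> (\<forall>v\<in>points I. weight I i v \<le> poly p (npoints I))"

text \<open>
  Poly-boundedness of a family of instances means one polynomial for the whole family. The budgets
  are unrestricted, and the index of the exceptional weight function may vary with the instance.
\<close>

definition rmkc_class :: "nat \<Rightarrow> nat poly \<Rightarrow> rmkc set" where
  "rmkc_class d p =
     {I. valid_rmkc I \<and> nweights I = d \<and> (\<exists>j. \<forall>i<d. i \<noteq> j \<longrightarrow> weight_bounded_by p I i)}"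

end

theory Submission
  imports Defs "HOL-Library.More_List"
begin

text \<open>
  Fix a candidate radius \<open>r\<close>. For a vector \<open>z\<close> indexed by the points, repeatedly pick a remaining
  point \<open>v\<close> with the largest \<open>z v\<close> and remove its cluster \<open>C\<close>, that is, the remaining points whose
  balls of radius \<open>r\<close> meet the ball of \<open>v\<close>. The balls of the picked points are disjoint, so dynamic
  programming over Pareto optimal states finds the best way of choosing at most one point in each of
  these balls within the budgets, where hitting the ball of \<open>v\<close> gains \<open>card C\<close>. Gaining \<open>m\<close> gives
  \<open>m\<close> points at distance at most \<open>3 r\<close>.

  Otherwise the vector \<open>a\<close> with \<open>a v = card C\<close> at the picked points and \<open>0\<close> elsewhere satisfies
  \<open>a \<bullet> y < m\<close> for the indicator \<open>y\<close> of the points covered by any feasible set, whereas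
  \<open>a \<bullet> z \<ge> \<Sum>z\<close> by the choice of the clusters. If some \<open>y\<close> covers \<open>m\<close> points, then either the sum of
  \<open>z\<close> is too small or \<open>a\<close> separates \<open>z\<close> from \<open>y\<close>. This replaces the ellipsoid method of the
  round-or-cut framework by a perceptron: a step along the separating direction brings a scaled \<open>z\<close>
  closer to \<open>y\<close> by a fixed amount, so after polynomially many rounds the dynamic program succeeds.
  The answer is taken from the least distance \<open>r\<close> for which it succeeds, which is at most the optimum.
\<close>

section \<open>Encodings\<close>

class enc =
  fixes enc :: "'a \<Rightarrow> data"

instantiation nat :: enc
begin
definition enc_nat :: "nat \<Rightarrow> data" where [simp]: "enc_nat n = Num n"
instance ..
end

instantiation bool :: enc
begin
definition enc_bool :: "bool \<Rightarrow> data" where [simp]: "enc_bool b = Num (if b then 1 else 0)"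
instance ..
end

instantiation prod :: (enc, enc) enc
begin
definition enc_prod :: "'a \<times> 'b \<Rightarrow> data" where [simp]: "enc_prod x = Cell (enc (fst x)) (enc (snd x))"
instance ..
end

instantiation list :: (enc) enc
begin
definition enc_list :: "'a list \<Rightarrow> data" where "enc_list = encode_list enc"
instance ..
end

lemma enc_list_simps [simp]:
  "enc ([] :: 'a::enc list) = Num 0"
  "enc (x # xs) = Cell (enc x) (enc (xs :: 'a::enc list))"
  by (simp_all add: enc_list_def)

abbreviation size_of :: "'a::enc \<Rightarrow> nat" where
  "size_of x \<equiv> bits (enc x)"

lemma bits_pos: "1 \<le> bits x"
  by (cases x) auto

lemma floorlog_le_self: "floorlog 2 n \<le> n"
proof (cases "n = 0")
  case False
  have "2 ^ (floorlog 2 n - 1) \<le> n" using False floorlog_bounds[of n 2] by simp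
  moreover have "floorlog 2 n - 1 < 2 ^ (floorlog 2 n - 1)" by (rule less_exp)
  ultimately show ?thesis by linarith
qed (simp add: floorlog_def)

lemma floorlog_add: "floorlog 2 (m + n) \<le> floorlog 2 m + floorlog 2 n"
proof (cases "m = 0 \<or> n = 0")
  case True then show ?thesis by (auto simp: floorlog_def)
next
  case False
  let ?a = "floorlog 2 m" and ?b = "floorlog 2 n"
  have pos: "1 \<le> ?a" "1 \<le> ?b" using False by (auto simp: floorlog_def)
  have "m < 2 ^ ?a" "n < 2 ^ ?b" using False floorlog_bounds[of m 2] floorlog_bounds[of n 2] by auto
  moreover have "(2::nat) ^ ?a \<le> 2 ^ (?a + ?b - 1)" "(2::nat) ^ ?b \<le> 2 ^ (?a + ?b - 1)"
    using pos by (auto intro!: power_increasing)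
  moreover have "(2::nat) * 2 ^ (?a + ?b - 1) = 2 ^ (?a + ?b)"
    using pos by (simp flip: power_Suc)
  ultimately have "m + n < 2 ^ (?a + ?b)" by linarith
  then show ?thesis by (simp add: floorlog_le_iff)
qed

lemma floorlog_mult: "floorlog 2 (m * n) \<le> floorlog 2 m + floorlog 2 n"
proof (cases "m = 0 \<or> n = 0")
  case True then show ?thesis by (auto simp: floorlog_def)
next
  case False
  have "m < 2 ^ floorlog 2 m" "n < 2 ^ floorlog 2 n" using False floorlog_bounds[of m 2] floorlog_bounds[of n 2] by auto
  then have "m * n < 2 ^ (floorlog 2 m + floorlog 2 n)"
    by (simp add: power_add mult_strict_mono)
  then show ?thesis by (simp add: floorlog_le_iff)
qed

lemma size_of_nat: "size_of (n :: nat) \<le> 1 + n"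
  using floorlog_le_self by simp

lemma size_of_list: "size_of (xs :: 'a::enc list) = 1 + (\<Sum>x\<leftarrow>xs. 1 + size_of x)"
  by (induction xs) (auto simp: floorlog_def)

lemma size_of_list_le:
  assumes "\<And>x. x \<in> set xs \<Longrightarrow> size_of x \<le> b"
  shows "size_of (xs :: 'a::enc list) \<le> 1 + length xs * (1 + b)"
  using assms by (induction xs) (force simp: floorlog_def)+

lemma length_le_size_of: "length (xs :: 'a::enc list) \<le> size_of xs"
  by (induction xs) auto

lemma size_of_member: "x \<in> set xs \<Longrightarrow> size_of x \<le> size_of (xs :: 'a::enc list)"
  by (induction xs) auto

section \<open>Polynomial bounds\<close>

named_theorems poly_bounded_intros

definition poly_bounded :: "'a::enc set \<Rightarrow> ('a \<Rightarrow> nat) \<Rightarrow> bool" where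
  "poly_bounded D g \<longleftrightarrow> (\<exists>c k. \<forall>x\<in>D. g x \<le> c * size_of x ^ k)"

lemma poly_bounded_const [poly_bounded_intros]: "poly_bounded D (\<lambda>x. c)"
  unfolding poly_bounded_def by (rule exI[of _ c], rule exI[of _ 0]) simp

lemma poly_bounded_size [poly_bounded_intros]: "poly_bounded D size_of"
  unfolding poly_bounded_def by (rule exI[of _ 1], rule exI[of _ 1]) simp

lemma poly_bounded_mono:
  "poly_bounded D g \<Longrightarrow> (\<And>x. x \<in> D \<Longrightarrow> f x \<le> g x) \<Longrightarrow> poly_bounded D f"
  unfolding poly_bounded_def by (meson order_trans)

lemma poly_bounded_subset: "poly_bounded D g \<Longrightarrow> E \<subseteq> D \<Longrightarrow> poly_bounded E g"
  unfolding poly_bounded_def by blast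

lemma poly_bounded_extend:
  assumes "poly_bounded {x \<in> D. b x} g"
  shows "poly_bounded D (\<lambda>x. if b x then g x else 0)"
proof -
  obtain c k where "\<forall>x\<in>{x \<in> D. b x}. g x \<le> c * size_of x ^ k"
    using assms unfolding poly_bounded_def by blast
  then show ?thesis unfolding poly_bounded_def by (intro exI[of _ c] exI[of _ k]) simp
qed

lemma poly_bounded_add [poly_bounded_intros]:
  assumes "poly_bounded D f" "poly_bounded D g"
  shows "poly_bounded D (\<lambda>x. f x + g x)"
proof -
  obtain c k c' k' where h: "\<And>x. x \<in> D \<Longrightarrow> f x \<le> c * size_of x ^ k"
    "\<And>x. x \<in> D \<Longrightarrow> g x \<le> c' * size_of x ^ k'"
    using assms unfolding poly_bounded_def by blast
  have "f x + g x \<le> (c + c') * size_of x ^ (k + k')" if "x \<in> D" for x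
  proof -
    have "size_of x ^ k \<le> size_of x ^ (k + k')" "size_of x ^ k' \<le> size_of x ^ (k + k')"
      using bits_pos by (auto intro!: power_increasing)
    then have "c * size_of x ^ k + c' * size_of x ^ k' \<le> (c + c') * size_of x ^ (k + k')"
      by (simp add: add_mono distrib_right)
    then show ?thesis using h[OF that] by linarith
  qed
  then show ?thesis unfolding poly_bounded_def by blast
qed

lemma poly_bounded_mult [poly_bounded_intros]:
  assumes "poly_bounded D f" "poly_bounded D g"
  shows "poly_bounded D (\<lambda>x. f x * g x)"
proof -
  obtain c k c' k' where h: "\<And>x. x \<in> D \<Longrightarrow> f x \<le> c * size_of x ^ k"
    "\<And>x. x \<in> D \<Longrightarrow> g x \<le> c' * size_of x ^ k'"
    using assms unfolding poly_bounded_def by blast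
  have "f x * g x \<le> (c * c') * size_of x ^ (k + k')" if "x \<in> D" for x
    using mult_mono[OF h[OF that]] by (simp add: power_add mult_ac)
  then show ?thesis unfolding poly_bounded_def by blast
qed

lemma poly_bounded_power [poly_bounded_intros]:
  "poly_bounded D f \<Longrightarrow> poly_bounded D (\<lambda>x. f x ^ k)"
  by (induction k) (auto intro: poly_bounded_intros)

lemma poly_bounded_poly [poly_bounded_intros]:
  "poly_bounded D g \<Longrightarrow> poly_bounded D (\<lambda>x. poly p (g x))"
  by (induction p) (auto intro: poly_bounded_intros)

lemma poly_bounded_comp:
  assumes "poly_bounded E g" "poly_bounded D (\<lambda>x. size_of (f x))" "\<And>x. x \<in> D \<Longrightarrow> f x \<in> E"
  shows "poly_bounded D (\<lambda>x. g (f x))"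
proof -
  obtain c k where h: "\<And>y. y \<in> E \<Longrightarrow> g y \<le> c * size_of y ^ k"
    using assms(1) unfolding poly_bounded_def by blast
  have "poly_bounded D (\<lambda>x. c * size_of (f x) ^ k)" by (intro poly_bounded_intros assms(2))
  then show ?thesis by (rule poly_bounded_mono) (use assms(3) h in blast)
qed

section \<open>Polynomial-time functions\<close>

definition poly_time :: "'a::enc set \<Rightarrow> ('a \<Rightarrow> 'b::enc) \<Rightarrow> bool" where
  "poly_time D f \<longleftrightarrow>
     (\<exists>A g. poly_bounded D g \<and> (\<forall>x\<in>D. \<exists>t\<le>g x. runs A (enc x) (enc (f x)) t))"

lemma poly_timeI:
  assumes "poly_bounded D g" "\<And>x. x \<in> D \<Longrightarrow> \<exists>t\<le>g x. runs A (enc x) (enc (f x)) t"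
  shows "poly_time D f"
  using assms unfolding poly_time_def by blast

lemma poly_timeE:
  assumes "poly_time D f"
  obtains A g where "poly_bounded D g" "\<And>x. x \<in> D \<Longrightarrow> \<exists>t\<le>g x. runs A (enc x) (enc (f x)) t"
  using assms unfolding poly_time_def by blast

lemma poly_time_size: "poly_time D f \<Longrightarrow> poly_bounded D (\<lambda>x. size_of (f x))"
  by (elim poly_timeE, rule poly_bounded_mono, assumption) (meson bits_result_le_cost order_trans)

lemma poly_time_subset: "poly_time D f \<Longrightarrow> E \<subseteq> D \<Longrightarrow> poly_time E f"
  by (elim poly_timeE, rule poly_timeI, erule poly_bounded_subset) auto

lemma poly_time_comp:
  assumes "poly_time E g" "poly_time D f" "\<And>x. x \<in> D \<Longrightarrow> f x \<in> E"
  shows "poly_time D (\<lambda>x. g (f x))"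
proof -
  obtain A a where A: "poly_bounded D a" "\<And>x. x \<in> D \<Longrightarrow> \<exists>t\<le>a x. runs A (enc x) (enc (f x)) t"
    by (rule poly_timeE[OF assms(2)]) (rule that)
  obtain B b where B: "poly_bounded E b" "\<And>x. x \<in> E \<Longrightarrow> \<exists>t\<le>b x. runs B (enc x) (enc (g x)) t"
    by (rule poly_timeE[OF assms(1)]) (rule that)
  have b: "poly_bounded D (\<lambda>x. b (f x))"
    using poly_bounded_comp[OF B(1) poly_time_size[OF assms(2)] assms(3)] .
  have "poly_bounded D (\<lambda>x. a x + b (f x) + 1)" by (intro poly_bounded_intros A(1) b)
  moreover have "\<exists>t\<le>a x + b (f x) + 1. runs (Seq A B) (enc x) (enc (g (f x))) t" if x: "x \<in> D" for x
  proof -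
    obtain s t where st: "s \<le> a x" "runs A (enc x) (enc (f x)) s" "t \<le> b (f x)"
      "runs B (enc (f x)) (enc (g (f x))) t"
      using A(2)[OF x] B(2)[OF assms(3)[OF x]] by blast
    show ?thesis
      using runs.Seq[OF st(2,4)] st(1,3) by (intro exI[of _ "s + t + 1"]) simp
  qed
  ultimately show ?thesis by (rule poly_timeI)
qed

named_theorems poly_time_intros

lemma poly_time_id [poly_time_intros]: "poly_time D (\<lambda>x. x)"
proof (rule poly_timeI)
  show "poly_bounded D (\<lambda>x. size_of x + size_of x)" by (intro poly_bounded_intros)
  show "\<exists>t\<le>size_of x + size_of x. runs (Prim Ident) (enc x) (enc x) t" for x :: 'a
    using runs.Prim[of Ident "enc x"] by (intro exI[of _ "size_of x + size_of x"]) simp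
qed

lemma poly_time_const [poly_time_intros]: "poly_time D (\<lambda>x. c)"
proof (rule poly_timeI)
  show "poly_bounded D (\<lambda>x. size_of x + size_of c)" by (intro poly_bounded_intros)
  show "\<exists>t\<le>size_of x + size_of c. runs (Const (enc c)) (enc x) (enc c) t" for x :: 'a
    using runs.Const[of "enc c" "enc x"] by auto
qed

lemma poly_time_Pair [poly_time_intros]:
  assumes "poly_time D f" "poly_time D g"
  shows "poly_time D (\<lambda>x. (f x, g x))"
proof -
  obtain A a where A: "poly_bounded D a" "\<And>x. x \<in> D \<Longrightarrow> \<exists>t\<le>a x. runs A (enc x) (enc (f x)) t"
    by (rule poly_timeE[OF assms(1)]) (rule that)
  obtain B b where B: "poly_bounded D b" "\<And>x. x \<in> D \<Longrightarrow> \<exists>t\<le>b x. runs B (enc x) (enc (g x)) t"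
    by (rule poly_timeE[OF assms(2)]) (rule that)
  let ?t = "\<lambda>x. a x + b x + size_of x + (1 + size_of (f x) + size_of (g x))"
  have "poly_bounded D ?t"
    by (intro poly_bounded_intros A(1) B(1) poly_time_size assms)
  then show ?thesis
  proof (rule poly_timeI)
    fix x assume x: "x \<in> D"
    then obtain s t where st: "s \<le> a x" "runs A (enc x) (enc (f x)) s" "t \<le> b x"
      "runs B (enc x) (enc (g x)) t"
      using A(2)[OF x] B(2)[OF x] by blast
    show "\<exists>t\<le>?t x. runs (Both A B) (enc x) (enc (f x, g x)) t"
      using runs.Both[OF st(2,4)] st(1,3)
      by (intro exI[of _ "s + t + size_of x + bits (Cell (enc (f x)) (enc (g x)))"]) simp
  qed
qed

lemma poly_time_cond:
  assumes "poly_time D b" "poly_time {x \<in> D. b x} f" "poly_time {x \<in> D. \<not> b x} g"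
  shows "poly_time D (\<lambda>x. if b x then f x else g x)"
proof -
  obtain C c where C: "poly_bounded D c" "\<And>x. x \<in> D \<Longrightarrow> \<exists>t\<le>c x. runs C (enc x) (enc (b x)) t"
    by (rule poly_timeE[OF assms(1)]) (rule that)
  obtain A a where A: "poly_bounded {x \<in> D. b x} a"
    "\<And>x. x \<in> {x \<in> D. b x} \<Longrightarrow> \<exists>t\<le>a x. runs A (enc x) (enc (f x)) t"
    by (rule poly_timeE[OF assms(2)]) (rule that)
  obtain B e where B: "poly_bounded {x \<in> D. \<not> b x} e"
    "\<And>x. x \<in> {x \<in> D. \<not> b x} \<Longrightarrow> \<exists>t\<le>e x. runs B (enc x) (enc (g x)) t"
    by (rule poly_timeE[OF assms(3)]) (rule that)
  let ?a = "\<lambda>x. if b x then a x else 0" and ?e = "\<lambda>x. if \<not> b x then e x else 0"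
  have ae: "poly_bounded D ?a" "poly_bounded D ?e"
    using A(1) B(1) by (simp_all add: poly_bounded_extend)
  have "poly_bounded D (\<lambda>x. c x + ?a x + ?e x + size_of x)"
    by (intro poly_bounded_add ae C(1) poly_bounded_size)
  then show ?thesis
  proof (rule poly_timeI)
    fix x assume x: "x \<in> D"
    obtain s where s: "s \<le> c x" "runs C (enc x) (enc (b x)) s" using C(2) x by blast
    show "\<exists>t\<le>c x + ?a x + ?e x + size_of x. runs (Cond C A B) (enc x) (enc (if b x then f x else g x)) t"
    proof (cases "b x")
      case True
      then obtain t where t: "t \<le> a x" "runs A (enc x) (enc (f x)) t" using A(2)[of x] x by auto
      show ?thesis using runs.CondT[OF s(2) _ t(2)] s(1) t(1) True
        by (intro exI[of _ "s + t + size_of x"]) simp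
    next
      case False
      then obtain t where t: "t \<le> e x" "runs B (enc x) (enc (g x)) t" using B(2)[of x] x by auto
      show ?thesis using runs.CondF[of C "enc x" s B, OF _ t(2)] s t(1) False
        by (intro exI[of _ "s + t + size_of x"]) simp
    qed
  qed
qed

lemma poly_time_if [poly_time_intros]:
  "poly_time D b \<Longrightarrow> poly_time D f \<Longrightarrow> poly_time D g \<Longrightarrow> poly_time D (\<lambda>x. if b x then f x else g x)"
  by (rule poly_time_cond) (erule poly_time_subset; blast)+

lemma poly_time_prim:
  assumes "\<And>x. x \<in> D \<Longrightarrow> apply_prim p (enc x) = enc (f x)" "\<And>x. x \<in> D \<Longrightarrow> size_of (f x) \<le> 1 + size_of x"
  shows "poly_time D f"
proof (rule poly_timeI)
  show "poly_bounded D (\<lambda>x. size_of x + (1 + size_of x))" by (intro poly_bounded_intros)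
  show "\<exists>t\<le>size_of x + (1 + size_of x). runs (Prim p) (enc x) (enc (f x)) t" if "x \<in> D" for x :: 'a
    using runs.Prim[of p "enc x"] assms[OF that]
    by (intro exI[of _ "size_of x + size_of (f x)"]) simp
qed

lemma poly_time_fst [poly_time_intros]: "poly_time D f \<Longrightarrow> poly_time D (\<lambda>x. fst (f x))"
  by (rule poly_time_comp[where E=UNIV, OF poly_time_prim[where p=First]]) auto

lemma poly_time_snd [poly_time_intros]: "poly_time D f \<Longrightarrow> poly_time D (\<lambda>x. snd (f x))"
  by (rule poly_time_comp[where E=UNIV, OF poly_time_prim[where p=Second]]) auto

lemma poly_time_hd: "poly_time {xs. xs \<noteq> []} hd"
  by (rule poly_time_prim[where p=First]) (auto simp: neq_Nil_conv)

lemma poly_time_tl: "poly_time UNIV tl"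
proof (rule poly_time_prim[where p=Second])
  fix xs :: "'a list"
  show "apply_prim Second (enc xs) = enc (tl xs)" "size_of (tl xs) \<le> 1 + size_of xs"
    by (cases xs; simp)+
qed

lemma poly_time_Cons [poly_time_intros]:
  "poly_time D f \<Longrightarrow> poly_time D g \<Longrightarrow> poly_time D (\<lambda>x. f x # g x)"
  using poly_time_Pair[of D f g] by (simp add: poly_time_def)

lemma poly_time_binop:
  fixes h :: "nat \<Rightarrow> nat \<Rightarrow> nat"
  assumes "\<And>m n. apply_prim p (Cell (Num m) (Num n)) = Num (h m n)"
    and "\<And>m n. floorlog 2 (h m n) \<le> 1 + floorlog 2 m + floorlog 2 n"
    and "poly_time D f" "poly_time D g"
  shows "poly_time D (\<lambda>x. h (f x) (g x))"
  by (rule poly_time_comp[where E=UNIV, OF poly_time_prim[where p=p, of _ "\<lambda>(m, n). h m n"]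
      poly_time_Pair[OF assms(3,4)], simplified]) (auto simp: assms(1,2) intro: order_trans[OF assms(2)])

lemma poly_time_add [poly_time_intros]:
  "poly_time D f \<Longrightarrow> poly_time D g \<Longrightarrow> poly_time D (\<lambda>x. f x + (g x :: nat))"
  by (rule poly_time_binop[where p=Plus]) (auto intro: le_SucI floorlog_add)

lemma poly_time_mult [poly_time_intros]:
  "poly_time D f \<Longrightarrow> poly_time D g \<Longrightarrow> poly_time D (\<lambda>x. f x * (g x :: nat))"
  by (rule poly_time_binop[where p=Times]) (auto intro: le_SucI floorlog_mult)

lemma poly_time_diff [poly_time_intros]:
  "poly_time D f \<Longrightarrow> poly_time D g \<Longrightarrow> poly_time D (\<lambda>x. f x - (g x :: nat))"
  by (rule poly_time_binop[where p=Monus]) (auto intro!: le_SucI trans_le_add1 floorlog_mono)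

lemma poly_time_less [poly_time_intros]:
  assumes "poly_time D f" "poly_time D g"
  shows "poly_time D (\<lambda>x. f x < (g x :: nat))"
proof -
  have "poly_time D (\<lambda>x. (\<lambda>m n. if m < n then 1 else 0) (f x) (g x) :: nat)"
    by (rule poly_time_binop[where p=Less]) (use assms in \<open>auto simp: floorlog_def\<close>)
  then show ?thesis by (simp add: poly_time_def)
qed

lemma poly_time_not [poly_time_intros]:
  assumes "poly_time D b"
  shows "poly_time D (\<lambda>x. \<not> b x)"
proof -
  have "(\<lambda>x. \<not> b x) = (\<lambda>x. if b x then False else True)" by auto
  then show ?thesis by (simp only:) (intro poly_time_intros assms)
qed

lemma poly_time_conj [poly_time_intros]:
  assumes "poly_time D b" "poly_time D c"
  shows "poly_time D (\<lambda>x. b x \<and> c x)"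
proof -
  have "(\<lambda>x. b x \<and> c x) = (\<lambda>x. if b x then c x else False)" by auto
  then show ?thesis by (simp only:) (intro poly_time_intros assms)
qed

lemma poly_time_le [poly_time_intros]:
  "poly_time D f \<Longrightarrow> poly_time D g \<Longrightarrow> poly_time D (\<lambda>x. f x \<le> (g x :: nat))"
  unfolding not_less[symmetric] by (intro poly_time_intros)

lemma poly_time_eq [poly_time_intros]:
  "poly_time D f \<Longrightarrow> poly_time D g \<Longrightarrow> poly_time D (\<lambda>x. f x = (g x :: nat))"
  unfolding eq_iff by (intro poly_time_intros)

lemma poly_time_Nil [poly_time_intros]:
  assumes "poly_time D f"
  shows "poly_time D (\<lambda>x. f x = ([] :: 'b::enc list))"
proof (rule poly_time_comp[where E=UNIV, OF poly_time_prim[where p=IsNum] assms])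
  fix xs :: "'b list"
  show "apply_prim IsNum (enc xs) = enc (xs = [])" by (cases xs) simp_all
  show "size_of (xs = []) \<le> 1 + size_of xs"
    by (cases xs) (simp_all add: compute_floorlog)
qed simp

section \<open>Bounded iteration\<close>

lemma size_of_drop: "size_of (drop k xs) \<le> size_of (xs :: 'a::enc list)"
proof (induction xs arbitrary: k)
  case (Cons x xs)
  show ?case
  proof (cases k)
    case (Suc m)
    then show ?thesis using Cons.IH[of m] by simp
  qed simp
qed simp

lemma runs_while:
  assumes "k \<le> n"
    and test: "\<And>i. i \<le> n \<Longrightarrow> \<exists>t\<le>a. runs C (st i) (Num (if i < n then 1 else 0)) t"
    and step: "\<And>i. i < n \<Longrightarrow> \<exists>t\<le>b. runs P (st i) (st (Suc i)) t"
    and size: "\<And>i. i \<le> n \<Longrightarrow> bits (st i) \<le> z"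
  shows "\<exists>t\<le>(Suc n - k) * (a + b + z). runs (While C P) (st k) (st n) t"
  using \<open>k \<le> n\<close>
proof (induction rule: inc_induct)
  case base
  obtain t where "t \<le> a" "runs C (st n) (Num 0) t" using test[of n] by auto
  then show ?case using size[of n] runs.WhileF[of C "st n" t P]
    by (intro exI[of _ "t + bits (st n)"]) simp
next
  case (step k)
  obtain s where s: "s \<le> a" "runs C (st k) (Num 1) s" using test[of k] \<open>k < n\<close> by auto
  obtain t where t: "t \<le> b" "runs P (st k) (st (Suc k)) t" using assms(3)[of k] \<open>k < n\<close> by auto
  obtain u where u: "u \<le> (Suc n - Suc k) * (a + b + z)" "runs (While C P) (st (Suc k)) (st n) u"
    using step.IH by auto
  have "Suc n - k = Suc (Suc n - Suc k)" using \<open>k < n\<close> by simp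
  then have "s + t + u + bits (st k) \<le> (Suc n - k) * (a + b + z)"
    using s(1) t(1) u(1) size[of k] \<open>k < n\<close> by simp
  then show ?case using runs.WhileT[OF s(2) _ t(2) u(2)] by auto
qed

lemma poly_time_foldl:
  fixes s0 :: "'a::enc \<Rightarrow> 's::enc" and xs :: "'a \<Rightarrow> 'y::enc list"
  assumes s0: "poly_time D s0" and xs: "poly_time D xs"
    and h: "poly_time {(x, s, y). x \<in> D \<and> (\<exists>k<length (xs x). J x k s \<and> y = xs x ! k)}
              (\<lambda>p. h (fst p) (fst (snd p)) (snd (snd p)))"
    and J0: "\<And>x. x \<in> D \<Longrightarrow> J x 0 (s0 x)"
    and JS: "\<And>x k s. x \<in> D \<Longrightarrow> k < length (xs x) \<Longrightarrow> J x k s \<Longrightarrow> J x (Suc k) (h x s (xs x ! k))"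
    and B: "poly_bounded D B"
      "\<And>x k s. x \<in> D \<Longrightarrow> k \<le> length (xs x) \<Longrightarrow> J x k s \<Longrightarrow> size_of s \<le> B x"
  shows "poly_time D (\<lambda>x. foldl (h x) (s0 x) (xs x))"
proof -
  let ?E = "{(x, s, l). x \<in> D \<and> (\<exists>k<length (xs x). J x k s \<and> l = drop k (xs x))}"
  let ?body = "\<lambda>p. (fst p, h (fst p) (fst (snd p)) (hd (snd (snd p))), tl (snd (snd p)))"
  have hd: "poly_time ?E (\<lambda>p. hd (snd (snd p)))"
    by (rule poly_time_comp[OF poly_time_hd]) (intro poly_time_intros, auto)
  have tl: "poly_time ?E (\<lambda>p. tl (snd (snd p)))"
    by (rule poly_time_comp[OF poly_time_tl]) (intro poly_time_intros, auto)
  have "poly_time ?E (\<lambda>p. h (fst (fst p, fst (snd p), hd (snd (snd p))))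
     (fst (snd (fst p, fst (snd p), hd (snd (snd p))))) (snd (snd (fst p, fst (snd p), hd (snd (snd p))))))"
    by (rule poly_time_comp[OF h]) (intro poly_time_intros hd, auto simp: hd_drop_conv_nth)
  then have body: "poly_time ?E ?body" by (simp only: fst_conv snd_conv) (intro poly_time_intros tl)
  have test: "poly_time UNIV (\<lambda>p :: 'a \<times> 's \<times> 'y list. \<not> snd (snd p) = [])"
    by (intro poly_time_intros)
  have pair: "poly_time D (\<lambda>x. (x, s0 x, xs x))" by (intro poly_time_intros s0 xs)
  obtain P b where P: "poly_bounded ?E b" "\<And>p. p \<in> ?E \<Longrightarrow> \<exists>t\<le>b p. runs P (enc p) (enc (?body p)) t"
    by (rule poly_timeE[OF body]) (rule that)
  obtain C a where C: "poly_bounded UNIV a"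
    "\<And>p :: 'a \<times> 's \<times> 'y list. p \<in> UNIV \<Longrightarrow> \<exists>t\<le>a p. runs C (enc p) (enc (\<not> snd (snd p) = [])) t"
    by (rule poly_timeE[OF test]) (rule that)
  obtain A e where A: "poly_bounded D e"
    "\<And>x. x \<in> D \<Longrightarrow> \<exists>t\<le>e x. runs A (enc x) (enc (x, s0 x, xs x)) t"
    by (rule poly_timeE[OF pair]) (rule that)
  obtain cb kb where b: "\<And>p. p \<in> ?E \<Longrightarrow> b p \<le> cb * size_of p ^ kb"
    using P(1) unfolding poly_bounded_def by blast
  obtain ca ka where a: "\<And>p. a p \<le> ca * size_of p ^ ka"
    using C(1) unfolding poly_bounded_def by blast
  define Z where "Z x = 2 + size_of x + B x + size_of (xs x)" for x
  have Z: "poly_bounded D Z"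
    unfolding Z_def by (intro poly_bounded_intros B(1) poly_time_size[OF xs])
  define T where "T x = e x + (1 + size_of (xs x)) * (ca * Z x ^ ka + cb * Z x ^ kb + Z x) + 1" for x
  have T: "poly_bounded D T"
    unfolding T_def by (intro poly_bounded_intros A(1) Z poly_time_size[OF xs])
  define st where "st x k = (x, foldl (h x) (s0 x) (take k (xs x)), drop k (xs x))" for x k
  have J: "J x k (foldl (h x) (s0 x) (take k (xs x)))" if "x \<in> D" "k \<le> length (xs x)" for x k
    using that(2)
  proof (induction k)
    case (Suc k)
    then show ?case using JS[of x k] that(1) by (simp add: take_Suc_conv_app_nth)
  qed (simp add: J0 that)
  have run: "\<exists>t\<le>T x. runs (Seq A (While C P)) (enc x) (enc (st x (length (xs x)))) t"
    if x: "x \<in> D" for x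
  proof -
    let ?n = "length (xs x)"
    have size: "size_of (st x k) \<le> Z x" if "k \<le> ?n" for k
      using B(2)[OF x that J[OF x that]] size_of_drop[of k "xs x"] by (simp add: st_def Z_def)
    have "\<exists>t\<le>(Suc ?n - 0) * (ca * Z x ^ ka + cb * Z x ^ kb + Z x).
      runs (While C P) (enc (st x 0)) (enc (st x ?n)) t"
    proof (rule runs_while)
      fix i assume i: "i \<le> ?n"
      have le: "a (st x i) \<le> ca * Z x ^ ka"
        by (rule order_trans[OF a]) (intro mult_left_mono power_mono size i zero_le)
      have "enc (\<not> snd (snd (st x i)) = []) = Num (if i < ?n then 1 else 0)"
        using i by (simp add: st_def)
      then show "\<exists>t\<le>ca * Z x ^ ka. runs C (enc (st x i)) (Num (if i < ?n then 1 else 0)) t"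
        using C(2)[of "st x i"] le by (metis UNIV_I order_trans)
    next
      fix i assume i: "i < ?n"
      have mem: "st x i \<in> ?E" using J[of x i] x i by (auto simp: st_def)
      have "b (st x i) \<le> cb * Z x ^ kb"
        by (rule order_trans[OF b[OF mem]]) (intro mult_left_mono power_mono size less_imp_le[OF i] zero_le)
      moreover have "?body (st x i) = st x (Suc i)"
        using i by (simp add: st_def take_Suc_conv_app_nth hd_drop_conv_nth drop_Suc tl_drop)
      ultimately show "\<exists>t\<le>cb * Z x ^ kb. runs P (enc (st x i)) (enc (st x (Suc i))) t"
        using P(2)[OF mem] by (metis order_trans)
    qed (use size in auto)
    then obtain t where t: "t \<le> Suc ?n * (ca * Z x ^ ka + cb * Z x ^ kb + Z x)"
      "runs (While C P) (enc (st x 0)) (enc (st x ?n)) t" by auto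
    have t': "t \<le> (1 + size_of (xs x)) * (ca * Z x ^ ka + cb * Z x ^ kb + Z x)"
      by (rule order_trans[OF t(1)]) (use length_le_size_of[of "xs x"] in \<open>simp only: Suc_eq_plus1_left, intro mult_right_mono add_left_mono; simp\<close>)
    obtain s where s: "s \<le> e x" "runs A (enc x) (enc (st x 0)) s"
      using A(2)[OF x] by (auto simp: st_def)
    show ?thesis using runs.Seq[OF s(2) t(2)] s(1) t'
      by (intro exI[of _ "s + t + 1"]) (simp add: T_def)
  qed
  have "poly_time D (\<lambda>x. st x (length (xs x)))"
    by (rule poly_timeI[OF T]) (rule run)
  then have "poly_time D (\<lambda>x. fst (snd (st x (length (xs x)))))" by (intro poly_time_intros)
  then show ?thesis by (simp add: st_def)
qed

section \<open>List functions\<close>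

lemma size_of_append: "size_of (xs @ ys) + 1 = size_of xs + size_of (ys :: 'a::enc list)"
  by (induction xs) (auto simp: floorlog_def)

lemma size_of_rev: "size_of (rev xs) = size_of (xs :: 'a::enc list)"
  by (simp add: size_of_list rev_map[symmetric] sum_list_rev)

lemma size_of_take: "size_of (take k xs) \<le> size_of (xs :: 'a::enc list)"
  using size_of_append[of "take k xs" "drop k xs"] bits_pos[of "enc (drop k xs)"] by simp

lemma poly_time_rev_append:
  assumes "poly_time D xs" "poly_time D ys"
  shows "poly_time D (\<lambda>x. rev (xs x) @ ys x)"
proof -
  have "poly_time D (\<lambda>x. foldl (\<lambda>s y. y # s) (ys x) (xs x))"
  proof (rule poly_time_foldl[where J = "\<lambda>x k s. s = rev (take k (xs x)) @ ys x"
        and B = "\<lambda>x. size_of (xs x) + size_of (ys x)"])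
    show "poly_bounded D (\<lambda>x. size_of (xs x) + size_of (ys x))"
      by (intro poly_bounded_intros poly_time_size assms)
    fix x k s assume "s = rev (take k (xs x)) @ ys x"
    then show "size_of s \<le> size_of (xs x) + size_of (ys x)"
      using size_of_append[of "rev (take k (xs x))" "ys x"] size_of_take[of k "xs x"]
      by (simp add: size_of_rev)
  qed (auto simp: take_Suc_conv_app_nth intro!: assms, (intro poly_time_intros))
  moreover have "foldl (\<lambda>s y. y # s) ys xs = rev xs @ ys" for xs ys :: "'b list"
    by (induction xs arbitrary: ys) auto
  ultimately show ?thesis by simp
qed

lemma poly_time_rev [poly_time_intros]: "poly_time D xs \<Longrightarrow> poly_time D (\<lambda>x. rev (xs x))"
  using poly_time_rev_append[OF _ poly_time_const[of D "[]"]] by simp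

lemma poly_time_append [poly_time_intros]:
  "poly_time D xs \<Longrightarrow> poly_time D ys \<Longrightarrow> poly_time D (\<lambda>x. xs x @ ys x)"
  using poly_time_rev_append[of D "\<lambda>x. rev (xs x)" ys] poly_time_rev[of D xs] by simp

lemma poly_bounded_member:
  assumes xs: "poly_time D xs"
    and g: "poly_bounded {(x, y). x \<in> D \<and> y \<in> set (xs x)} g"
  obtains B where "poly_bounded D B" "\<And>x y. x \<in> D \<Longrightarrow> y \<in> set (xs x) \<Longrightarrow> g (x, y) \<le> B x"
proof -
  obtain c k where h: "\<And>p. p \<in> {(x, y). x \<in> D \<and> y \<in> set (xs x)} \<Longrightarrow> g p \<le> c * size_of p ^ k"
    using g unfolding poly_bounded_def by blast
  show ?thesis
  proof (rule that)
    show "poly_bounded D (\<lambda>x. c * (1 + size_of x + size_of (xs x)) ^ k)"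
      by (intro poly_bounded_intros poly_time_size xs)
    fix x y assume "x \<in> D" "y \<in> set (xs x)"
    then have "g (x, y) \<le> c * size_of (x, y) ^ k" using h[of "(x, y)"] by simp
    also have "\<dots> \<le> c * (1 + size_of x + size_of (xs x)) ^ k"
      using size_of_member[OF \<open>y \<in> set (xs x)\<close>] by (intro mult_left_mono power_mono) simp_all
    finally show "g (x, y) \<le> c * (1 + size_of x + size_of (xs x)) ^ k" .
  qed
qed

lemma poly_time_concat_map [poly_time_intros]:
  assumes xs: "poly_time D xs"
    and f: "poly_time {(x, y). x \<in> D \<and> y \<in> set (xs x)} (\<lambda>p. f (fst p) (snd p))"
  shows "poly_time D (\<lambda>x. concat (map (f x) (xs x)) :: 'b::enc list)"
proof -
  obtain B where B: "poly_bounded D B"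
    "\<And>x y. x \<in> D \<Longrightarrow> y \<in> set (xs x) \<Longrightarrow> size_of (f (fst (x, y)) (snd (x, y))) \<le> B x"
    by (rule poly_bounded_member[OF xs poly_time_size[OF f]]) (rule that)
  let ?s = "\<lambda>x k. rev (concat (map (f x) (take k (xs x))))"
  have "poly_time D (\<lambda>x. foldl (\<lambda>s y. rev (f x y) @ s) [] (xs x))"
  proof (rule poly_time_foldl[where J = "\<lambda>x k s. s = ?s x k"
        and B = "\<lambda>x. 1 + size_of (xs x) * B x" and h = "\<lambda>x s y. rev (f x y) @ s"])
    show "poly_bounded D (\<lambda>x. 1 + size_of (xs x) * B x)"
      by (intro poly_bounded_intros poly_time_size xs B)
    fix x k s assume x: "x \<in> D" "s = ?s x k"
    have "size_of (concat (map (f x) ys)) \<le> 1 + length ys * B x" if "set ys \<subseteq> set (xs x)" for ys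
      using that
    proof (induction ys)
      case (Cons y ys)
      then show ?case
        using size_of_append[of "f x y" "concat (map (f x) ys)"] B(2)[OF x(1), of y] by simp
    qed (simp add: floorlog_def)
    from this[of "take k (xs x)"] have "size_of s \<le> 1 + length (take k (xs x)) * B x"
      using x(2) by (simp add: size_of_rev set_take_subset)
    also have "\<dots> \<le> 1 + size_of (xs x) * B x"
      using length_le_size_of[of "xs x"] by (intro add_left_mono mult_right_mono) simp_all
    finally show "size_of s \<le> 1 + size_of (xs x) * B x" .
  next
    let ?E = "{(x, s, y). x \<in> D \<and> (\<exists>k<length (xs x). s = ?s x k \<and> y = xs x ! k)}"
    have "poly_time ?E (\<lambda>p. f (fst (fst p, snd (snd p))) (snd (fst p, snd (snd p))))"
      by (rule poly_time_comp[OF f]) (intro poly_time_intros, auto)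
    then have "poly_time ?E (\<lambda>p. f (fst p) (snd (snd p)))" by simp
    then show "poly_time ?E (\<lambda>p. rev (f (fst p) (snd (snd p))) @ fst (snd p))"
      by (intro poly_time_rev_append poly_time_intros)
  next
    show "poly_time D (\<lambda>x. [])" by (rule poly_time_const)
  qed (auto simp: take_Suc_conv_app_nth intro!: xs)
  then have "poly_time D (\<lambda>x. rev (foldl (\<lambda>s y. rev (f x y) @ s) [] (xs x)))"
    by (intro poly_time_rev)
  moreover have "foldl (\<lambda>s y. rev (g y) @ s) s ys = rev (concat (map g ys)) @ s" for g :: "'c \<Rightarrow> 'b list" and s ys
    by (induction ys arbitrary: s) auto
  ultimately show ?thesis by simp
qed

lemma poly_time_map [poly_time_intros]:
  assumes "poly_time D xs"
    and "poly_time {(x, y). x \<in> D \<and> y \<in> set (xs x)} (\<lambda>p. f (fst p) (snd p))"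
  shows "poly_time D (\<lambda>x. map (f x) (xs x))"
proof -
  have "map g ys = concat (map (\<lambda>y. [g y]) ys)" for g :: "'b \<Rightarrow> 'c" and ys by (induction ys) auto
  then have "(\<lambda>x. map (f x) (xs x)) = (\<lambda>x. concat (map (\<lambda>y. [f x y]) (xs x)))" by blast
  then show ?thesis by (simp only:) (intro poly_time_intros assms)
qed

lemma poly_time_filter [poly_time_intros]:
  assumes "poly_time D xs"
    and "poly_time {(x, y). x \<in> D \<and> y \<in> set (xs x)} (\<lambda>p. P (fst p) (snd p))"
  shows "poly_time D (\<lambda>x. filter (P x) (xs x))"
proof -
  have "filter Q ys = concat (map (\<lambda>y. if Q y then [y] else []) ys)" for Q :: "'b \<Rightarrow> bool" and ys
    by (induction ys) auto
  then show ?thesis by (simp only:) (intro poly_time_intros assms)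
qed

lemma poly_time_Ball [poly_time_intros]:
  assumes "poly_time D xs"
    and "poly_time {(x, y). x \<in> D \<and> y \<in> set (xs x)} (\<lambda>p. P (fst p) (snd p))"
  shows "poly_time D (\<lambda>x. \<forall>y\<in>set (xs x). P x y)"
proof -
  have "(\<forall>y\<in>set ys. Q y) \<longleftrightarrow> filter (\<lambda>y. \<not> Q y) ys = []" for Q :: "'b \<Rightarrow> bool" and ys
    by (simp add: filter_empty_conv)
  then show ?thesis by (simp only:) (intro poly_time_intros assms)
qed

lemma poly_time_Bex [poly_time_intros]:
  assumes "poly_time D xs"
    and "poly_time {(x, y). x \<in> D \<and> y \<in> set (xs x)} (\<lambda>p. P (fst p) (snd p))"
  shows "poly_time D (\<lambda>x. \<exists>y\<in>set (xs x). P x y)"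
proof -
  have "(\<exists>y\<in>set ys. Q y) \<longleftrightarrow> \<not> filter Q ys = []" for Q :: "'b \<Rightarrow> bool" and ys
    by (simp add: filter_empty_conv)
  then show ?thesis by (simp only:) (intro poly_time_intros assms)
qed

lemma poly_time_sum_list [poly_time_intros]:
  assumes "poly_time D xs"
  shows "poly_time D (\<lambda>x. sum_list (xs x :: nat list))"
proof -
  have size: "size_of (sum_list ys) \<le> size_of ys" for ys :: "nat list"
  proof (induction ys)
    case (Cons y ys)
    then show ?case using floorlog_add[of y "sum_list ys"] by simp
  qed simp
  have "poly_time D (\<lambda>x. foldl (\<lambda>s y. s + y) 0 (xs x))"
  proof (rule poly_time_foldl[where J = "\<lambda>x k s. s = sum_list (take k (xs x))"
        and B = "\<lambda>x. size_of (xs x)"])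
    fix x k s assume "s = sum_list (take k (xs x))"
    then show "size_of s \<le> size_of (xs x)"
      using size[of "take k (xs x)"] size_of_take[of k "xs x"] by simp
  qed (intro poly_time_intros poly_time_size assms | simp add: take_Suc_conv_app_nth)+
  moreover have "foldl (\<lambda>s y. s + y) s ys = s + sum_list ys" for s and ys :: "nat list"
    by (induction ys arbitrary: s) auto
  ultimately show ?thesis by simp
qed

lemma poly_time_length [poly_time_intros]:
  assumes "poly_time D xs"
  shows "poly_time D (\<lambda>x. length (xs x))"
proof -
  have "length ys = (\<Sum>y\<leftarrow>ys. 1)" for ys :: "'b list" by (induction ys) auto
  then show ?thesis by (simp only:) (intro poly_time_intros assms)
qed

lemma poly_time_upt_length [poly_time_intros]:
  assumes "poly_time D xs"
  shows "poly_time D (\<lambda>x. [0..<length (xs x)])"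
proof -
  have "poly_time D (\<lambda>x. foldl (\<lambda>s y. s @ [length s]) [] (xs x))"
  proof (rule poly_time_foldl[where J = "\<lambda>x k s. s = [0..<k]"
        and B = "\<lambda>x. 1 + size_of (xs x) * (2 + size_of (xs x))"])
    fix x k s assume "k \<le> length (xs x)" and s: "s = [0..<k]"
    then have k: "k \<le> size_of (xs x)" using length_le_size_of[of "xs x"] by simp
    have "size_of s \<le> 1 + length s * (1 + (1 + size_of (xs x)))"
    proof (rule size_of_list_le)
      fix i assume "i \<in> set s"
      then show "size_of i \<le> 1 + size_of (xs x)" using size_of_nat[of i] s k by simp
    qed
    also have "\<dots> \<le> 1 + size_of (xs x) * (2 + size_of (xs x))"
      using s k by (intro add_left_mono mult_mono) simp_all
    finally show "size_of s \<le> 1 + size_of (xs x) * (2 + size_of (xs x))" .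
  qed (intro poly_time_intros poly_bounded_intros poly_time_size assms | simp)+
  moreover have "foldl (\<lambda>s y. s @ [length s]) [0..<k] ys = [0..<k + length ys]" for k and ys :: "'b list"
  proof (induction ys arbitrary: k)
    case (Cons y ys)
    then show ?case using Cons.IH[of "Suc k"] by simp
  qed simp
  from this[of 0] have "foldl (\<lambda>s y. s @ [length s]) [] ys = [0..<length ys]" for ys :: "'b list"
    by simp
  ultimately show ?thesis by simp
qed

lemma poly_time_nth_default [poly_time_intros]:
  assumes xs: "poly_time D xs" and i: "poly_time D i"
  shows "poly_time D (\<lambda>x. nth_default c (xs x) (i x))"
proof -
  let ?J = "\<lambda>x k s. s = (k, nth_default c (take k (xs x)) (i x))"
  let ?h = "\<lambda>x s y. (fst s + 1, if fst s = i x then y else snd s)"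
  have "poly_time D (\<lambda>x. foldl (?h x) (0, c) (xs x))"
  proof (rule poly_time_foldl[where J = ?J and B = "\<lambda>x. 2 + 2 * size_of (xs x) + size_of c"])
    let ?E = "{(x, s, y). x \<in> D \<and> (\<exists>k<length (xs x). ?J x k s \<and> y = xs x ! k)}"
    have "poly_time ?E (\<lambda>p. i (fst p))"
      by (rule poly_time_comp[OF i]) (intro poly_time_intros, auto)
    then show "poly_time ?E (\<lambda>p. ?h (fst p) (fst (snd p)) (snd (snd p)))"
      by (intro poly_time_intros)
    fix x k s assume k: "k \<le> length (xs x)" and s: "?J x k s"
    have "size_of (nth_default c (take k (xs x)) (i x)) \<le> size_of (xs x) + size_of c"
      using size_of_member[OF nth_mem[of "i x" "xs x"]] by (auto simp: nth_default_def)
    then show "size_of s \<le> 2 + 2 * size_of (xs x) + size_of c"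
      using s size_of_nat[of k] k length_le_size_of[of "xs x"] by simp
  next
    fix x k s assume "k < length (xs x)" "?J x k s"
    then show "?J x (Suc k) (?h x s (xs x ! k))"
      by (auto simp: nth_default_def take_Suc_conv_app_nth nth_append)
  qed (intro poly_time_intros poly_bounded_intros poly_time_size assms | simp)+
  then have "poly_time D (\<lambda>x. snd (foldl (?h x) (0, c) (xs x)))" by (intro poly_time_intros)
  moreover have key: "snd (foldl (?h x) (k, r) ys) =
      (if k \<le> i x \<and> i x < k + length ys then ys ! (i x - k) else r)" for x k r ys
    by (induction ys arbitrary: k r) (auto simp: nth_Cons' simp del: diff_is_0_eq)
  have "snd (foldl (?h x) (0, c) (xs x)) = nth_default c (xs x) (i x)" for x
    using key[of x 0 c "xs x"] by (simp add: nth_default_def)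
  ultimately show ?thesis by simp
qed

section \<open>Clusters\<close>

definition adj :: "bool list list \<Rightarrow> nat \<Rightarrow> nat \<Rightarrow> bool" where
  "adj G u v = nth_default False (nth_default [] G u) v"

definition near :: "bool list list \<Rightarrow> nat list \<Rightarrow> nat \<Rightarrow> nat \<Rightarrow> bool" where
  "near G P u v \<longleftrightarrow> (\<exists>w\<in>set P. adj G u w \<and> adj G v w)"

definition argmax :: "nat list \<Rightarrow> nat list \<Rightarrow> nat" where
  "argmax z R = nth_default 0 (filter (\<lambda>v. \<forall>u\<in>set R. nth_default 0 z u \<le> nth_default 0 z v) R) 0"

definition cluster_step ::
  "bool list list \<Rightarrow> nat list \<Rightarrow> nat list \<Rightarrow> nat list \<times> (nat \<times> nat list) list \<Rightarrow>
   nat list \<times> (nat \<times> nat list) list" where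
  "cluster_step G P z s =
     (if fst s = [] then s
      else (filter (\<lambda>u. \<not> near G P u (argmax z (fst s))) (fst s),
            (argmax z (fst s), filter (\<lambda>u. near G P u (argmax z (fst s))) (fst s)) # snd s))"

definition clusters :: "bool list list \<Rightarrow> nat list \<Rightarrow> nat list \<Rightarrow> (nat \<times> nat list) list" where
  "clusters G P z = snd (foldl (\<lambda>s _. cluster_step G P z s) (P, []) P)"

lemma near_commute: "near G P u v \<longleftrightarrow> near G P v u"
  by (auto simp: near_def)

lemma argmax:
  assumes "R \<noteq> []"
  shows "argmax z R \<in> set R" "u \<in> set R \<Longrightarrow> nth_default 0 z u \<le> nth_default 0 z (argmax z R)"
proof -
  let ?M = "filter (\<lambda>v. \<forall>u\<in>set R. nth_default 0 z u \<le> nth_default 0 z v) R"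
  have "Max (nth_default 0 z ` set R) \<in> nth_default 0 z ` set R" using assms by (intro Max_in) auto
  then obtain v where v: "v \<in> set R" "nth_default 0 z v = Max (nth_default 0 z ` set R)" by force
  have "\<forall>u\<in>set R. nth_default 0 z u \<le> nth_default 0 z v" unfolding v(2) by auto
  then have "?M \<noteq> []" using v(1) by (auto simp: filter_empty_conv)
  then have "argmax z R = ?M ! 0" unfolding argmax_def by (intro nth_default_nth) simp
  then have "argmax z R \<in> set ?M" using \<open>?M \<noteq> []\<close> by (metis length_greater_0_conv nth_mem)
  then show "argmax z R \<in> set R" "u \<in> set R \<Longrightarrow> nth_default 0 z u \<le> nth_default 0 z (argmax z R)"
    by auto
qed

definition cluster_invariant where
  "cluster_invariant G P z k s \<longleftrightarrow>
     distinct (fst s) \<and> set (fst s) \<subseteq> set P \<and> length (fst s) + k \<le> max k (length P) \<and>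
     length (snd s) \<le> k \<and>
     mset (concat (map snd (snd s)) @ fst s) = mset P \<and>
     (\<forall>c\<in>set (snd s). fst c \<in> set P \<and>
        (\<forall>u\<in>set (snd c). near G P u (fst c) \<and> nth_default 0 z u \<le> nth_default 0 z (fst c)) \<and>
        (\<forall>u\<in>set (fst s). \<not> near G P u (fst c))) \<and>
     sorted_wrt (\<lambda>c c'. \<not> near G P (fst c) (fst c')) (snd s)"

lemma mset_filter_partition: "mset (filter Q xs) + mset (filter (\<lambda>x. \<not> Q x) xs) = mset xs"
  by (induction xs) auto

lemma cluster_invariant_step:
  assumes refl: "\<And>u. u \<in> set P \<Longrightarrow> adj G u u" and inv: "cluster_invariant G P z k s"
  shows "cluster_invariant G P z (Suc k) (cluster_step G P z s)"
proof (cases "fst s = []")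
  case True
  then show ?thesis using inv by (simp add: cluster_invariant_def cluster_step_def)
next
  case False
  let ?R = "fst s" and ?v = "argmax z (fst s)"
  let ?N = "filter (\<lambda>u. \<not> near G P u ?v) ?R" and ?C = "filter (\<lambda>u. near G P u ?v) ?R"
  have s': "cluster_step G P z s = (?N, (?v, ?C) # snd s)"
    using False by (simp add: cluster_step_def)
  have v: "?v \<in> set ?R" and max: "\<And>u. u \<in> set ?R \<Longrightarrow> nth_default 0 z u \<le> nth_default 0 z ?v"
    using argmax[OF False] by auto
  have "?v \<in> set P" using v inv by (auto simp: cluster_invariant_def)
  then have "near G P ?v ?v" using refl by (auto simp: near_def)
  then have "length ?N < length ?R" using v by (intro length_filter_less) auto
  moreover have "mset ?C + mset ?N = mset ?R" by (rule mset_filter_partition)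
  ultimately show ?thesis
    using inv \<open>?v \<in> set P\<close> v max
    unfolding cluster_invariant_def s' by (auto simp: near_commute ac_simps)
qed

locale cover_graph =
  fixes G :: "bool list list" and P :: "nat list"
  assumes distinct_points: "distinct P" and adj_refl: "u \<in> set P \<Longrightarrow> adj G u u"
begin

lemma clusters_invariant: "\<exists>k. cluster_invariant G P z k ([], clusters G P z)"
proof -
  have "cluster_invariant G P z (length xs) (foldl (\<lambda>s _. cluster_step G P z s) (P, []) xs)" for xs
  proof (induction xs rule: rev_induct)
    case Nil
    show ?case by (simp add: cluster_invariant_def distinct_points)
  next
    case (snoc x xs)
    then show ?case using cluster_invariant_step[OF adj_refl] by simp
  qed
  from this[of P] have inv: "cluster_invariant G P z (length P) (foldl (\<lambda>s _. cluster_step G P z s) (P, []) P)" .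
  then have "fst (foldl (\<lambda>s _. cluster_step G P z s) (P, []) P) = []"
    by (simp add: cluster_invariant_def)
  then have "foldl (\<lambda>s _. cluster_step G P z s) (P, []) P = ([], clusters G P z)"
    unfolding clusters_def by (metis prod.collapse)
  with inv show ?thesis by auto
qed

lemma mset_clusters: "mset (concat (map snd (clusters G P z))) = mset P"
  using clusters_invariant[of z] by (auto simp: cluster_invariant_def)

lemma clusters_center: "(v, C) \<in> set (clusters G P z) \<Longrightarrow> v \<in> set P"
  using clusters_invariant[of z] by (fastforce simp: cluster_invariant_def)

lemma clusters_near: "(v, C) \<in> set (clusters G P z) \<Longrightarrow> u \<in> set C \<Longrightarrow> near G P u v"
  using clusters_invariant[of z] by (fastforce simp: cluster_invariant_def)

lemma clusters_max:
  "(v, C) \<in> set (clusters G P z) \<Longrightarrow> u \<in> set C \<Longrightarrow> nth_default 0 z u \<le> nth_default 0 z v"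
  using clusters_invariant[of z] by (fastforce simp: cluster_invariant_def)

lemma clusters_separated: "sorted_wrt (\<lambda>c c'. \<not> near G P (fst c) (fst c')) (clusters G P z)"
  using clusters_invariant[of z] by (auto simp: cluster_invariant_def)

lemma sum_clusters: "(\<Sum>c\<leftarrow>clusters G P z. \<Sum>u\<leftarrow>snd c. f u) = (\<Sum>u\<in>set P. f u)"
proof -
  have "(\<Sum>c\<leftarrow>cs. \<Sum>u\<leftarrow>snd c. f u) = sum_list (map f (concat (map snd cs)))" for cs :: "('b \<times> nat list) list"
    by (induction cs) auto
  then have "(\<Sum>c\<leftarrow>clusters G P z. \<Sum>u\<leftarrow>snd c. f u) = sum_list (map f (concat (map snd (clusters G P z))))" .
  also have "\<dots> = sum_mset (image_mset f (mset (concat (map snd (clusters G P z)))))"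
    by (metis mset_map sum_mset_sum_list)
  also have "\<dots> = sum_list (map f P)"
    unfolding mset_clusters by (metis mset_map sum_mset_sum_list)
  also have "\<dots> = (\<Sum>u\<in>set P. f u)" using distinct_points by (rule sum_list_distinct_conv_sum_set)
  finally show ?thesis .
qed

end

section \<open>Dynamic programming over the clusters\<close>

definition load :: "nat list \<Rightarrow> nat list \<Rightarrow> nat" where
  "load r S = (\<Sum>u\<leftarrow>S. nth_default 0 r u)"

lemma load_simps [simp]: "load r [] = 0" "load r (u # S) = nth_default 0 r u + load r S"
  by (simp_all add: load_def)

text \<open>A state pairs the number of points gained so far with the points selected for it.\<close>

definition dominates :: "nat list list \<Rightarrow> nat \<times> nat list \<Rightarrow> nat \<times> nat list \<Rightarrow> bool" where
  "dominates W s t \<longleftrightarrow>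
     fst t \<le> fst s \<and> (\<forall>r\<in>set W. load r (snd s) \<le> load r (snd t))"

definition insert_state where
  "insert_state W L s =
     (if \<exists>t\<in>set L. dominates W t s then L else s # filter (\<lambda>t. \<not> dominates W s t) L)"

definition prune where
  "prune W L = foldl (insert_state W) [] L"

definition extend_states ::
  "bool list list \<Rightarrow> nat list \<Rightarrow> (nat \<times> nat list) list \<Rightarrow> nat \<times> nat list \<Rightarrow> (nat \<times> nat list) list" where
  "extend_states G P L c =
     L @ concat (map (\<lambda>u. map (\<lambda>s. (fst s + length (snd c), u # snd s)) L) (filter (adj G (fst c)) P))"

definition states ::
  "bool list list \<Rightarrow> nat list \<Rightarrow> nat list list \<Rightarrow> (nat \<times> nat list) list \<Rightarrow> (nat \<times> nat list) list" where
  "states G P W cs = foldl (\<lambda>L c. prune W (extend_states G P L c)) [(0, [])] cs"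

definition selections ::
  "bool list list \<Rightarrow> nat list \<Rightarrow> nat list list \<Rightarrow> nat list \<Rightarrow> nat \<Rightarrow> (nat \<times> nat list) list \<Rightarrow> nat list list" where
  "selections G P W B m cs = map snd (filter (\<lambda>s. m \<le> fst s \<and>
     (\<forall>i\<in>set [0..<length W]. load (nth_default [] W i) (snd s) \<le> nth_default 0 B i)) (states G P W cs))"

lemma dominates_refl: "dominates W s s"
  by (simp add: dominates_def)

lemma dominates_trans: "dominates W s t \<Longrightarrow> dominates W t u \<Longrightarrow> dominates W s u"
  unfolding dominates_def by (meson order_trans)

definition pareto where
  "pareto W L \<longleftrightarrow> sorted_wrt (\<lambda>s t. \<not> dominates W s t \<and> \<not> dominates W t s) L"

lemma prune:
  shows set_prune: "set (prune W L) \<subseteq> set L"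
    and prune_dominates: "s \<in> set L \<Longrightarrow> \<exists>t\<in>set (prune W L). dominates W t s"
    and pareto_prune: "pareto W (prune W L)"
proof -
  have "set (prune W L) \<subseteq> set L \<and> (\<forall>s\<in>set L. \<exists>t\<in>set (prune W L). dominates W t s) \<and> pareto W (prune W L)"
  proof (induction L rule: rev_induct)
    case Nil
    show ?case by (simp add: prune_def pareto_def)
  next
    case (snoc a L)
    let ?L = "prune W L"
    have eq: "prune W (L @ [a]) = insert_state W ?L a" by (simp add: prune_def)
    show ?case
    proof (cases "\<exists>t\<in>set ?L. dominates W t a")
      case True
      then show ?thesis using snoc.IH unfolding eq by (auto simp: insert_state_def)
    next
      case False
      then have eq': "prune W (L @ [a]) = a # filter (\<lambda>t. \<not> dominates W a t) ?L"
        unfolding eq by (simp add: insert_state_def)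
      have "\<exists>t\<in>set (prune W (L @ [a])). dominates W t s" if "s \<in> set (L @ [a])" for s
      proof (cases "s = a")
        case True
        then show ?thesis by (auto simp: eq' dominates_refl)
      next
        case False
        then obtain t where t: "t \<in> set ?L" "dominates W t s" using snoc.IH \<open>s \<in> set (L @ [a])\<close> by auto
        show ?thesis
        proof (cases "dominates W a t")
          case True
          then show ?thesis using dominates_trans[OF True t(2)] by (simp add: eq')
        qed (use t in \<open>intro bexI[of _ t]; simp add: eq'\<close>)
      qed
      moreover have "pareto W (prune W (L @ [a]))"
        using snoc.IH False unfolding eq' pareto_def by (auto intro: sorted_wrt_filter)
      ultimately show ?thesis using snoc.IH by (auto simp: eq')
    qed
  qed
  then show "set (prune W L) \<subseteq> set L" "s \<in> set L \<Longrightarrow> \<exists>t\<in>set (prune W L). dominates W t s"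
    "pareto W (prune W L)" by auto
qed

text \<open>
  Two states that agree in the gain and in all totals but one are comparable, so a Pareto list is
  short although the totals of one weight function are unbounded.
\<close>

lemma length_pareto:
  assumes "pareto W L" and gain: "\<And>s. s \<in> set L \<Longrightarrow> fst s \<le> V"
    and load: "\<And>s i. s \<in> set L \<Longrightarrow> i < length W \<Longrightarrow> i \<noteq> j \<Longrightarrow> load (W ! i) (snd s) \<le> M"
  shows "length L \<le> (V + 1) * (M + 1) ^ length W"
proof -
  let ?d = "length W"
  define key where
    "key s = (fst s, restrict (\<lambda>i. if i = j then 0 else load (W ! i) (snd s)) {..<?d})" for s :: "nat \<times> nat list"
  have comparable: "dominates W s t \<or> dominates W t s" if "key s = key t" for s t
  proof -
    have fst: "fst s = fst t" using that by (simp add: key_def)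
    have eq: "load (W ! i) (snd s) = load (W ! i) (snd t)" if "i < ?d" "i \<noteq> j" for i
    proof -
      have "snd (key s) i = snd (key t) i" by (simp only: \<open>key s = key t\<close>)
      then show ?thesis using that by (simp add: key_def)
    qed
    have "dominates W a b" if "fst b \<le> fst a" "\<And>i. i < ?d \<Longrightarrow> i \<noteq> j \<Longrightarrow> load (W ! i) (snd a) \<le> load (W ! i) (snd b)"
      "j < ?d \<Longrightarrow> load (W ! j) (snd a) \<le> load (W ! j) (snd b)" for a b
      using that unfolding dominates_def by (metis in_set_conv_nth)
    then show ?thesis using fst eq by (metis le_cases order_refl)
  qed
  have "distinct (map key L)"
    using assms(1) unfolding pareto_def
  proof (induction L)
    case (Cons s L)
    have "key s \<noteq> key t" if "t \<in> set L" for t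
      using Cons.prems that comparable[of s t] by auto
    then show ?case using Cons by auto
  qed simp
  then have "length L = card (key ` set L)"
    by (metis distinct_card length_map set_map)
  also have "\<dots> \<le> card ({..V} \<times> (PiE {..<?d} (\<lambda>_. {..M})))"
  proof (rule card_mono)
    show "finite ({..V} \<times> (PiE {..<?d} (\<lambda>_. {..M})))" by (auto intro!: finite_PiE)
    show "key ` set L \<subseteq> {..V} \<times> (PiE {..<?d} (\<lambda>_. {..M}))"
    proof (rule image_subsetI)
      fix s assume s: "s \<in> set L"
      have "restrict (\<lambda>i. if i = j then 0 else load (W ! i) (snd s)) {..<?d} \<in> PiE {..<?d} (\<lambda>_. {..M})"
        using load[OF s] by (subst restrict_PiE_iff) simp
      then show "key s \<in> {..V} \<times> (PiE {..<?d} (\<lambda>_. {..M}))"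
        unfolding key_def mem_Times_iff fst_conv snd_conv using gain[OF s] by blast
    qed
  qed
  also have "\<dots> = (V + 1) * (M + 1) ^ ?d" by (simp add: card_cartesian_product card_PiE)
  finally show ?thesis .
qed

lemma states_snoc: "states G P W (cs @ [c]) = prune W (extend_states G P (states G P W cs) c)"
  by (simp add: states_def)

lemma extend_statesE:
  assumes "s' \<in> set (extend_states G P L c)"
  obtains "s' \<in> set L"
  | u s where "s \<in> set L" "u \<in> set P" "adj G (fst c) u" "s' = (fst s + length (snd c), u # snd s)"
  using assms by (auto simp: extend_states_def)

lemma extend_statesI:
  "s \<in> set L \<Longrightarrow> s \<in> set (extend_states G P L c)"
  "s \<in> set L \<Longrightarrow> u \<in> set P \<Longrightarrow> adj G (fst c) u \<Longrightarrow> (fst s + length (snd c), u # snd s) \<in> set (extend_states G P L c)"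
  by (force simp: extend_states_def)+

definition gain :: "bool list list \<Rightarrow> (nat \<times> nat list) list \<Rightarrow> nat set \<Rightarrow> nat" where
  "gain G cs T = (\<Sum>c\<leftarrow>cs. if \<exists>u\<in>T. adj G (fst c) u then length (snd c) else 0)"

lemma gain_mono: "T \<subseteq> T' \<Longrightarrow> gain G cs T \<le> gain G cs T'"
  unfolding gain_def by (intro sum_list_mono) auto

lemma states_sound:
  "s \<in> set (states G P W cs) \<Longrightarrow>
     set (snd s) \<subseteq> set P \<and> length (snd s) \<le> length cs \<and> fst s \<le> gain G cs (set (snd s))"
proof (induction cs arbitrary: s rule: rev_induct)
  case Nil
  then show ?case by (simp add: states_def)
next
  case (snoc c cs)
  from snoc.prems have "s \<in> set (extend_states G P (states G P W cs) c)"
    using set_prune by (auto simp: states_snoc)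
  then show ?case
  proof (cases rule: extend_statesE)
    case 1
    then show ?thesis using snoc.IH[OF 1] by (auto simp: gain_def)
  next
    case (2 u t)
    have "gain G cs (set (snd t)) \<le> gain G cs (set (snd s))" by (rule gain_mono) (auto simp: 2)
    then show ?thesis using snoc.IH[OF 2(1)] 2 by (auto simp: gain_def)
  qed
qed

lemma states_complete:
  assumes "finite T" "T \<subseteq> set P" "sorted_wrt (\<lambda>c c'. \<not> near G P (fst c) (fst c')) cs"
  shows "\<exists>s\<in>set (states G P W cs). gain G cs T \<le> fst s \<and>
    (\<forall>r\<in>set W. load r (snd s) \<le> (\<Sum>u\<in>{u \<in> T. \<exists>c\<in>set cs. adj G (fst c) u}. nth_default 0 r u))"
  using assms(3)
proof (induction cs rule: rev_induct)
  case Nil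
  show ?case by (simp add: states_def gain_def)
next
  case (snoc c cs)
  let ?T = "\<lambda>cs. {u \<in> T. \<exists>c\<in>set cs. adj G (fst c) u}"
  let ?w = "\<lambda>r cs. \<Sum>u\<in>?T cs. nth_default 0 r u"
  have "\<exists>s\<in>set (states G P W cs). gain G cs T \<le> fst s \<and> (\<forall>r\<in>set W. load r (snd s) \<le> ?w r cs)"
    using snoc by (auto simp: sorted_wrt_append)
  then obtain s where s: "s \<in> set (states G P W cs)" "gain G cs T \<le> fst s"
    "\<And>r. r \<in> set W \<Longrightarrow> load r (snd s) \<le> ?w r cs" by blast
  have mono: "?w r cs \<le> ?w r (cs @ [c])" for r :: "nat list"
    using assms(1) by (intro sum_mono2) auto
  have "\<exists>t\<in>set (extend_states G P (states G P W cs) c). gain G (cs @ [c]) T \<le> fst t \<and>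
    (\<forall>r\<in>set W. load r (snd t) \<le> ?w r (cs @ [c]))"
  proof (cases "\<exists>u\<in>T. adj G (fst c) u")
    case False
    show ?thesis
    proof (intro bexI[OF _ extend_statesI(1)[OF s(1)]] conjI ballI)
      show "gain G (cs @ [c]) T \<le> fst s" using s(2) False by (simp add: gain_def)
      show "load r (snd s) \<le> ?w r (cs @ [c])" if "r \<in> set W" for r
        using s(3)[OF that] mono by (rule order_trans)
    qed
  next
    case True
    then obtain u where u: "u \<in> T" "adj G (fst c) u" by blast
    have "u \<notin> ?T cs" using snoc.prems u assms(2) by (auto simp: sorted_wrt_append near_def)
    have "load r (u # snd s) \<le> ?w r (cs @ [c])" if "r \<in> set W" for r
    proof -
      have "load r (u # snd s) \<le> nth_default 0 r u + ?w r cs" using s(3)[OF that] by simp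
      also have "\<dots> = (\<Sum>v\<in>insert u (?T cs). nth_default 0 r v)"
        using \<open>u \<notin> ?T cs\<close> assms(1) by simp
      also have "\<dots> \<le> ?w r (cs @ [c])" using assms(1) u by (intro sum_mono2) auto
      finally show ?thesis .
    qed
    then show ?thesis
      using extend_statesI(2)[OF s(1), of u P G c] u s(2) True assms(2)
      by (intro bexI[of _ "(fst s + length (snd c), u # snd s)"]) (auto simp: gain_def)
  qed
  then obtain t where t: "t \<in> set (extend_states G P (states G P W cs) c)" "gain G (cs @ [c]) T \<le> fst t"
    "\<And>r. r \<in> set W \<Longrightarrow> load r (snd t) \<le> ?w r (cs @ [c])" by blast
  obtain t' where t': "t' \<in> set (states G P W (cs @ [c]))" "dominates W t' t"
    unfolding states_snoc using prune_dominates[OF t(1), of W] by blast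
  then show ?case using t(2,3) unfolding dominates_def by (meson order_trans)
qed

definition covered :: "bool list list \<Rightarrow> nat list \<Rightarrow> nat set \<Rightarrow> nat set" where
  "covered G P T = {v \<in> set P. \<exists>u\<in>T. adj G v u}"

definition within_budget :: "nat list list \<Rightarrow> nat list \<Rightarrow> nat set \<Rightarrow> bool" where
  "within_budget W B S \<longleftrightarrow> (\<forall>i<length W. (\<Sum>u\<in>S. nth_default 0 (W ! i) u) \<le> nth_default 0 B i)"

lemma sum_set_le_sum_list: "(\<Sum>u\<in>set S. f u) \<le> (\<Sum>u\<leftarrow>S. f u :: nat)"
  by (induction S) (auto simp: sum.insert_if)

lemma selections_sound:
  assumes "S \<in> set (selections G P W B m cs)"
  shows "set S \<subseteq> set P" "within_budget W B (set S)" "m \<le> gain G cs (set S)"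
proof -
  obtain v where s: "(v, S) \<in> set (states G P W cs)" "m \<le> v"
    "\<And>i. i < length W \<Longrightarrow> load (nth_default [] W i) S \<le> nth_default 0 B i"
    using assms by (auto simp: selections_def)
  show "set S \<subseteq> set P" "m \<le> gain G cs (set S)" using states_sound[OF s(1)] s(2) by auto
  show "within_budget W B (set S)"
    unfolding within_budget_def
  proof (intro allI impI)
    fix i assume "i < length W"
    then show "(\<Sum>u\<in>set S. nth_default 0 (W ! i) u) \<le> nth_default 0 B i"
      using s(3)[of i] sum_set_le_sum_list[of "nth_default 0 (W ! i)" S]
      by (simp add: nth_default_nth load_def)
  qed
qed

lemma selections_complete:
  assumes T: "T \<subseteq> set P" "within_budget W B T"
    and "sorted_wrt (\<lambda>c c'. \<not> near G P (fst c) (fst c')) cs" "m \<le> gain G cs T"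
  shows "selections G P W B m cs \<noteq> []"
proof -
  have fin: "finite T" using T(1) finite_subset by blast
  obtain s where s: "s \<in> set (states G P W cs)" "gain G cs T \<le> fst s"
    "\<And>r. r \<in> set W \<Longrightarrow>
       load r (snd s) \<le> (\<Sum>u\<in>{u \<in> T. \<exists>c\<in>set cs. adj G (fst c) u}. nth_default 0 r u)"
    using states_complete[OF fin T(1) assms(3), of W] by blast
  have "load (nth_default [] W i) (snd s) \<le> nth_default 0 B i" if i: "i < length W" for i
  proof -
    have "load (W ! i) (snd s) \<le> (\<Sum>u\<in>{u \<in> T. \<exists>c\<in>set cs. adj G (fst c) u}. nth_default 0 (W ! i) u)"
      using s(3) i by simp
    also have "\<dots> \<le> (\<Sum>u\<in>T. nth_default 0 (W ! i) u)" using fin by (intro sum_mono2) auto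
    also have "\<dots> \<le> nth_default 0 B i" using T(2) i by (simp add: within_budget_def)
    finally show ?thesis using i by (simp add: nth_default_nth)
  qed
  then have "snd s \<in> set (selections G P W B m cs)"
    using s(1,2) assms(4) by (auto simp: selections_def)
  then show ?thesis by auto
qed

section \<open>The perceptron iteration\<close>

definition perceptron_step where
  "perceptron_step G P W B m z =
     (if selections G P W B m (clusters G P z) \<noteq> [] then z
      else if 2 * (\<Sum>u\<leftarrow>P. nth_default 0 z u) + 2 * length P * length P < 2 * m * (2 * length P * length P)
      then map (\<lambda>u. nth_default 0 z u + 1) P
      else map (\<lambda>u. nth_default 0 z u - (\<Sum>c\<leftarrow>clusters G P z. if fst c = u then length (snd c) else 0)) P)"

definition rounds :: "nat list \<Rightarrow> nat list" where
  "rounds P = concat (map (\<lambda>a. concat (map (\<lambda>b. concat (map (\<lambda>c. [0, 0, 0, 0, 0]) P)) P)) P)"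

definition search where
  "search G P W B m =
     selections G P W B m (clusters G P
       (foldl (\<lambda>z _. perceptron_step G P W B m z) (map (\<lambda>u. 0) P) (rounds P)))"

lemma length_rounds: "length (rounds P) = 5 * length P ^ 3"
proof -
  have "length (concat (map f xs)) = k * length xs" if "\<And>x. length (f x) = k" for f :: "nat \<Rightarrow> nat list" and xs k
    using that by (induction xs) auto
  then show ?thesis by (simp add: rounds_def power3_eq_cube)
qed

lemma nth_default_map_points:
  assumes "P = [0..<n]" "u < n"
  shows "nth_default 0 (map f P) u = f u"
  using assms by (simp add: nth_default_nth)

context cover_graph
begin

lemma gain_clusters_le:
  "gain G (clusters G P z) S \<le> card {u \<in> set P. \<exists>v\<in>covered G P S. near G P u v}"
proof -
  let ?U = "{u \<in> set P. \<exists>v\<in>covered G P S. near G P u v}"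
  have "gain G (clusters G P z) S \<le> (\<Sum>c\<leftarrow>clusters G P z. \<Sum>u\<leftarrow>snd c. of_bool (u \<in> ?U))"
    unfolding gain_def
  proof (rule sum_list_mono)
    fix c assume c: "c \<in> set (clusters G P z)"
    have "u \<in> ?U" if "u \<in> set (snd c)" "w \<in> S" "adj G (fst c) w" for u w
    proof -
      have "u \<in> set P" using mset_eq_setD[OF mset_clusters[of z]] c that(1) by auto
      moreover have "fst c \<in> covered G P S"
        using clusters_center[of "fst c" "snd c" z] c that(2,3) by (auto simp: covered_def)
      ultimately show ?thesis using clusters_near[of "fst c" "snd c" z u] c that(1) by auto
    qed
    moreover have "(\<Sum>u\<leftarrow>xs. of_bool (u \<in> ?U)) = length xs" if "set xs \<subseteq> ?U" for xs
      using that by (induction xs) auto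
    ultimately show "(if \<exists>u\<in>S. adj G (fst c) u then length (snd c) else 0) \<le> (\<Sum>u\<leftarrow>snd c. of_bool (u \<in> ?U))"
      by (auto simp: subset_iff)
  qed
  also have "\<dots> = (\<Sum>u\<in>set P. of_bool (u \<in> ?U))" by (rule sum_clusters)
  also have "\<dots> = card ?U" by (simp add: sum_of_bool_eq Int_def)
  finally show ?thesis .
qed

lemma search_sound:
  assumes "S \<in> set (search G P W B m)"
  shows "set S \<subseteq> set P" "within_budget W B (set S)"
    "m \<le> card {u \<in> set P. \<exists>v\<in>covered G P (set S). near G P u v}"
  using selections_sound[OF assms[unfolded search_def]] gain_clusters_le order_trans by blast+

end

lemma sum_point_weights:
  fixes f :: "nat \<Rightarrow> int"
  assumes "finite A" "fst ` set cs \<subseteq> A"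
  shows "(\<Sum>u\<in>A. int (\<Sum>c\<leftarrow>cs. if fst c = u then k c else 0) * f u) = (\<Sum>c\<leftarrow>cs. int (k c) * f (fst c))"
  using assms(2)
proof (induction cs)
  case (Cons c cs)
  have "(\<Sum>u\<in>A. int (if fst c = u then k c else 0) * f u) = (\<Sum>u\<in>A. if fst c = u then int (k c) * f u else 0)"
    by (intro sum.cong) auto
  also have "\<dots> = int (k c) * f (fst c)" using Cons.prems assms(1) by (simp add: sum.delta')
  finally show ?case using Cons by (simp add: distrib_right sum.distrib)
qed simp

lemma sum_squares_le_square_sum:
  fixes f :: "'a \<Rightarrow> int"
  assumes "finite A" "\<And>a. a \<in> A \<Longrightarrow> 0 \<le> f a"
  shows "(\<Sum>a\<in>A. (f a)\<^sup>2) \<le> (\<Sum>a\<in>A. f a)\<^sup>2"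
  using assms
proof (induction A rule: finite_induct)
  case (insert a A)
  have "0 \<le> f a * sum f A" using insert by (simp add: sum_nonneg)
  then show ?case using insert by (simp add: power2_sum)
qed simp

lemma clamped_square_le:
  fixes z a :: nat and b :: int
  assumes "0 \<le> b"
  shows "(int (z - a) - b)\<^sup>2 \<le> (int z - b)\<^sup>2 - 2 * (int a * (int z - b)) + (int a)\<^sup>2"
proof -
  have "(int (z - a) - b)\<^sup>2 \<le> (int z - int a - b)\<^sup>2"
  proof (cases "a \<le> z")
    case False
    then show ?thesis using assms by (auto simp: abs_le_square_iff[symmetric])
  qed (simp add: of_nat_diff)
  also have "\<dots> = (int z - b)\<^sup>2 - 2 * (int a * (int z - b)) + (int a)\<^sup>2"
    by (simp add: power2_eq_square algebra_simps)
  finally show ?thesis .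
qed

definition potential :: "nat list \<Rightarrow> nat set \<Rightarrow> nat list \<Rightarrow> int" where
  "potential P Y z = (\<Sum>u\<in>set P. (int (nth_default 0 z u) - int (2 * length P * length P) * of_bool (u \<in> Y))\<^sup>2)"

context cover_graph
begin

lemma sum_le_sum_clusters:
  "(\<Sum>u\<in>set P. int (nth_default 0 z u)) \<le>
     (\<Sum>c\<leftarrow>clusters G P z. int (length (snd c)) * int (nth_default 0 z (fst c)))"
proof -
  have "(\<Sum>u\<in>set P. int (nth_default 0 z u)) =
      (\<Sum>c\<leftarrow>clusters G P z. \<Sum>u\<leftarrow>snd c. int (nth_default 0 z u))"
    by (rule sum_clusters[symmetric])
  also have "\<dots> \<le> (\<Sum>c\<leftarrow>clusters G P z. int (length (snd c)) * int (nth_default 0 z (fst c)))"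
  proof (rule sum_list_mono)
    fix c assume c: "c \<in> set (clusters G P z)"
    have "(\<Sum>u\<leftarrow>snd c. int (nth_default 0 z u)) \<le> (\<Sum>u\<leftarrow>snd c. int (nth_default 0 z (fst c)))"
      by (rule sum_list_mono) (use clusters_max[of "fst c" "snd c" z] c in auto)
    also have "\<dots> = int (length (snd c)) * int (nth_default 0 z (fst c))"
      by (simp add: sum_list_triv)
    finally show "(\<Sum>u\<leftarrow>snd c. int (nth_default 0 z u)) \<le> int (length (snd c)) * int (nth_default 0 z (fst c))" .
  qed
  finally show ?thesis .
qed

lemma potential_decreases:
  assumes P: "P = [0..<n]"
    and T: "T \<subseteq> set P" "within_budget W B T" "m \<le> card (covered G P T)"
    and fail: "selections G P W B m (clusters G P z) = []"
  shows "potential P (covered G P T) (perceptron_step G P W B m z) \<le> potential P (covered G P T) z - (int n)\<^sup>2"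
proof -
  let ?cs = "clusters G P z" and ?Y = "covered G P T"
  let ?N = "int (2 * n * n)"
  define x where "x u = int (nth_default 0 z u)" for u
  define y where "y u = (of_bool (u \<in> ?Y) :: int)" for u
  define a where "a u = (\<Sum>c\<leftarrow>?cs. if fst c = u then length (snd c) else 0)" for u
  have len: "length P = n" by (simp add: P)
  have Y: "?Y \<subseteq> set P" by (auto simp: covered_def)
  have sum_y: "(\<Sum>u\<in>set P. y u) = int (card ?Y)"
    using Y by (simp add: y_def sum_of_bool_eq Int_absorb1)
  have sum_x: "(\<Sum>u\<in>set P. x u) = int (\<Sum>u\<leftarrow>P. nth_default 0 z u)"
    using distinct_points by (simp add: x_def sum_list_distinct_conv_sum_set)
  have before: "potential P ?Y z = (\<Sum>u\<in>set P. (x u - ?N * y u)\<^sup>2)"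
    by (simp add: potential_def x_def y_def len)
  have nth: "u \<in> set P \<Longrightarrow> nth_default 0 (map f P) u = f u" for f u
    by (rule nth_default_map_points[OF P]) (simp add: P)
  show ?thesis
  proof (cases "2 * (\<Sum>u\<leftarrow>P. nth_default 0 z u) + 2 * n * n < 2 * m * (2 * n * n)")
    case True
    then have "perceptron_step G P W B m z = map (\<lambda>u. nth_default 0 z u + 1) P"
      using fail by (simp add: perceptron_step_def len)
    then have "potential P ?Y (perceptron_step G P W B m z) = (\<Sum>u\<in>set P. (x u + 1 - ?N * y u)\<^sup>2)"
      unfolding potential_def by (intro sum.cong refl) (simp add: nth x_def y_def len add.commute)
    also have "\<dots> = (\<Sum>u\<in>set P. (x u - ?N * y u)\<^sup>2 + (2 * x u - 2 * ?N * y u + 1))"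
      by (intro sum.cong refl) (simp add: power2_eq_square algebra_simps)
    also have "\<dots> = potential P ?Y z + (2 * (\<Sum>u\<in>set P. x u) - 2 * ?N * (\<Sum>u\<in>set P. y u) + int n)"
      unfolding before by (simp add: sum.distrib sum_subtractf sum_distrib_left P)
    finally have eq: "potential P ?Y (perceptron_step G P W B m z) =
      potential P ?Y z + (2 * (\<Sum>u\<in>set P. x u) - 2 * ?N * (\<Sum>u\<in>set P. y u) + int n)" .
    have "int (2 * (\<Sum>u\<leftarrow>P. nth_default 0 z u) + 2 * n * n) < int (2 * m * (2 * n * n))"
      using True by (simp only: of_nat_less_iff)
    then have "2 * (\<Sum>u\<in>set P. x u) + ?N < 2 * ?N * int m" unfolding sum_x by (simp add: mult_ac)
    moreover have "2 * ?N * int m \<le> 2 * ?N * (\<Sum>u\<in>set P. y u)"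
      unfolding sum_y using T(3) by (intro mult_left_mono) simp_all
    moreover have "?N = 2 * (int n)\<^sup>2" "int n \<le> (int n)\<^sup>2"
      by (simp_all add: power2_eq_square) (metis le_square of_nat_le_iff of_nat_mult)
    ultimately show ?thesis using eq by linarith
  next
    case False
    then have "perceptron_step G P W B m z = map (\<lambda>u. nth_default 0 z u - a u) P"
      using fail by (simp add: perceptron_step_def len a_def)
    then have "potential P ?Y (perceptron_step G P W B m z) = (\<Sum>u\<in>set P. (int (nth_default 0 z u - a u) - ?N * y u)\<^sup>2)"
      unfolding potential_def by (intro sum.cong refl) (simp add: nth y_def len)
    also have "\<dots> \<le> (\<Sum>u\<in>set P. (x u - ?N * y u)\<^sup>2 - 2 * (int (a u) * (x u - ?N * y u)) + (int (a u))\<^sup>2)"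
      unfolding x_def by (intro sum_mono clamped_square_le) (simp add: y_def)
    also have "\<dots> = potential P ?Y z - 2 * (\<Sum>u\<in>set P. int (a u) * x u)
        + 2 * ?N * (\<Sum>u\<in>set P. int (a u) * y u) + (\<Sum>u\<in>set P. (int (a u))\<^sup>2)"
      unfolding before by (simp add: sum.distrib sum_subtractf sum_distrib_left algebra_simps)
    finally have le: "potential P ?Y (perceptron_step G P W B m z) \<le> potential P ?Y z
        - 2 * (\<Sum>u\<in>set P. int (a u) * x u) + 2 * ?N * (\<Sum>u\<in>set P. int (a u) * y u)
        + (\<Sum>u\<in>set P. (int (a u))\<^sup>2)" .
    have centers: "fst ` set ?cs \<subseteq> set P" using clusters_center by fastforce
    note weights = sum_point_weights[OF finite_set centers, of "\<lambda>c. length (snd c)", folded a_def]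
    have ax: "(\<Sum>u\<in>set P. x u) \<le> (\<Sum>u\<in>set P. int (a u) * x u)"
      unfolding weights x_def by (rule sum_le_sum_clusters)
    have "(\<Sum>u\<in>set P. int (a u) * y u) = int (gain G ?cs T)"
    proof -
      have "int (length (snd c)) * y (fst c) = int (if \<exists>u\<in>T. adj G (fst c) u then length (snd c) else 0)"
        if "c \<in> set ?cs" for c
        using that centers by (auto simp: y_def covered_def)
      moreover have "(\<Sum>c\<leftarrow>xs. int (f c)) = int (\<Sum>c\<leftarrow>xs. f c)" for f and xs :: "(nat \<times> nat list) list"
        by (induction xs) auto
      ultimately show ?thesis unfolding weights gain_def by (metis (no_types, lifting) map_cong)
    qed
    moreover have "gain G ?cs T < m"
      using selections_complete[OF T(1,2) clusters_separated] fail not_le by blast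
    ultimately have ay: "?N * (\<Sum>u\<in>set P. int (a u) * y u) \<le> ?N * (int m - 1)"
      by (intro mult_left_mono) simp_all
    have "(\<Sum>u\<in>set P. int (a u)) = int n"
      using weights[of "\<lambda>_. 1"] sum_clusters[of "\<lambda>_. 1::int" z] by (simp add: sum_list_triv P)
    then have a2: "(\<Sum>u\<in>set P. (int (a u))\<^sup>2) \<le> (int n)\<^sup>2"
      using sum_squares_le_square_sum[of "set P" "\<lambda>u. int (a u)"] by simp
    have "int (2 * m * (2 * n * n)) \<le> int (2 * (\<Sum>u\<leftarrow>P. nth_default 0 z u) + 2 * n * n)"
      using False by (simp only: of_nat_le_iff not_less)
    then have "2 * int m * ?N \<le> 2 * (\<Sum>u\<in>set P. x u) + ?N" unfolding sum_x by simp
    moreover have "?N * (int m - 1) = int m * ?N - ?N" by (simp add: algebra_simps)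
    moreover have "?N = 2 * (int n)\<^sup>2" by (simp add: power2_eq_square)
    ultimately show ?thesis using le ax ay a2 by linarith
  qed
qed

lemma search_complete:
  assumes P: "P = [0..<n]" "0 < n"
    and T: "T \<subseteq> set P" "within_budget W B T" "m \<le> card (covered G P T)"
  shows "search G P W B m \<noteq> []"
proof
  let ?Y = "covered G P T" and ?init = "map (\<lambda>u. 0) P"
  let ?z = "\<lambda>xs :: nat list. foldl (\<lambda>z _. perceptron_step G P W B m z) ?init xs"
  let ?fail = "\<lambda>z. selections G P W B m (clusters G P z) = []"
  assume "search G P W B m = []"
  then have fail: "?fail (?z (rounds P))" by (simp add: search_def)
  have "?fail (?z xs) \<longrightarrow> potential P ?Y (?z xs) \<le> potential P ?Y ?init - int (length xs) * (int n)\<^sup>2" for xs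
  proof (induction xs rule: rev_induct)
    case (snoc a xs)
    show ?case
    proof (cases "?fail (?z xs)")
      case True
      then show ?thesis
        using snoc potential_decreases[OF P(1) T True] by (simp add: algebra_simps)
    next
      case False
      then have "?z (xs @ [a]) = ?z xs" by (simp add: perceptron_step_def)
      then show ?thesis using False by simp
    qed
  qed simp
  from this[of "rounds P"] fail
  have "potential P ?Y (?z (rounds P)) \<le> potential P ?Y ?init - 5 * int n ^ 3 * (int n)\<^sup>2"
    by (simp add: length_rounds P)
  moreover have "potential P ?Y ?init \<le> (\<Sum>u\<in>set P. (int (2 * n * n))\<^sup>2)"
    unfolding potential_def by (intro sum_mono) (simp add: P nth_default_def)
  then have "potential P ?Y ?init \<le> 4 * int n ^ 3 * (int n)\<^sup>2"
    by (simp add: P power2_eq_square power3_eq_cube algebra_simps)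
  moreover have "0 \<le> potential P ?Y (?z (rounds P))"
    unfolding potential_def by (intro sum_nonneg) simp
  moreover have "0 < int n ^ 3 * (int n)\<^sup>2" using P(2) by simp
  ultimately show False by linarith
qed

end

section \<open>Running time of the search\<close>

lemma poly_time_lift2:
  assumes "poly_time E (\<lambda>p. f (fst p) (snd p))" "poly_time D a" "poly_time D b"
    and "\<And>x. x \<in> D \<Longrightarrow> (a x, b x) \<in> E"
  shows "poly_time D (\<lambda>x. f (a x) (b x))"
  using poly_time_comp[OF assms(1) poly_time_Pair[OF assms(2,3)] assms(4)] by simp

lemma poly_time_lift3:
  assumes "poly_time E (\<lambda>p. f (fst p) (fst (snd p)) (snd (snd p)))"
    and "poly_time D a" "poly_time D b" "poly_time D c" "\<And>x. x \<in> D \<Longrightarrow> (a x, b x, c x) \<in> E"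
  shows "poly_time D (\<lambda>x. f (a x) (b x) (c x))"
  using poly_time_lift2[where f = "\<lambda>a p. f a (fst p) (snd p)",
      OF assms(1,2) poly_time_Pair[OF assms(3,4)] assms(5)] by simp

lemma poly_time_lift4:
  assumes "poly_time E (\<lambda>p. f (fst p) (fst (snd p)) (fst (snd (snd p))) (snd (snd (snd p))))"
    and "poly_time D a" "poly_time D b" "poly_time D c" "poly_time D e"
    and "\<And>x. x \<in> D \<Longrightarrow> (a x, b x, c x, e x) \<in> E"
  shows "poly_time D (\<lambda>x. f (a x) (b x) (c x) (e x))"
  using poly_time_lift3[where f = "\<lambda>a b p. f a b (fst p) (snd p)",
      OF assms(1-3) poly_time_Pair[OF assms(4,5)] assms(6)] by simp

lemma poly_time_lift5:
  assumes "poly_time E (\<lambda>p. f (fst p) (fst (snd p)) (fst (snd (snd p))) (fst (snd (snd (snd p))))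
      (snd (snd (snd (snd p)))))"
    and "poly_time D a" "poly_time D b" "poly_time D c" "poly_time D e" "poly_time D g"
    and "\<And>x. x \<in> D \<Longrightarrow> (a x, b x, c x, e x, g x) \<in> E"
  shows "poly_time D (\<lambda>x. f (a x) (b x) (c x) (e x) (g x))"
  using poly_time_lift4[where f = "\<lambda>a b c p. f a b c (fst p) (snd p)",
      OF assms(1-4) poly_time_Pair[OF assms(5,6)] assms(7)] by simp

lemma poly_time_lift6:
  assumes "poly_time E (\<lambda>p. f (fst p) (fst (snd p)) (fst (snd (snd p))) (fst (snd (snd (snd p))))
      (fst (snd (snd (snd (snd p))))) (snd (snd (snd (snd (snd p))))))"
    and "poly_time D a" "poly_time D b" "poly_time D c" "poly_time D e" "poly_time D g" "poly_time D h"
    and "\<And>x. x \<in> D \<Longrightarrow> (a x, b x, c x, e x, g x, h x) \<in> E"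
  shows "poly_time D (\<lambda>x. f (a x) (b x) (c x) (e x) (g x) (h x))"
  using poly_time_lift5[where f = "\<lambda>a b c e p. f a b c e (fst p) (snd p)",
      OF assms(1-5) poly_time_Pair[OF assms(6,7)] assms(8)] by simp

lemma poly_time_adj [poly_time_intros]:
  "poly_time D G \<Longrightarrow> poly_time D u \<Longrightarrow> poly_time D v \<Longrightarrow> poly_time D (\<lambda>x. adj (G x) (u x) (v x))"
  unfolding adj_def by (intro poly_time_intros)

lemma poly_time_near [poly_time_intros]:
  assumes "poly_time D G" "poly_time D P" "poly_time D u" "poly_time D v"
  shows "poly_time D (\<lambda>x. near (G x) (P x) (u x) (v x))"
  by (rule poly_time_lift4[OF _ assms UNIV_I]) (unfold near_def, intro poly_time_intros)

lemma poly_time_argmax [poly_time_intros]: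
  assumes "poly_time D z" "poly_time D R"
  shows "poly_time D (\<lambda>x. argmax (z x) (R x))"
  by (rule poly_time_lift2[OF _ assms UNIV_I]) (unfold argmax_def, intro poly_time_intros)

lemma cluster_step_sizes:
  assumes "length (fst s) \<le> length P" "set (fst s) \<subseteq> set P" "length (snd s) \<le> k"
    and "\<forall>c\<in>set (snd s). fst c \<in> set P \<and> set (snd c) \<subseteq> set P \<and> length (snd c) \<le> length P"
  shows "length (fst (cluster_step G P z s)) \<le> length P \<and> set (fst (cluster_step G P z s)) \<subseteq> set P \<and>
    length (snd (cluster_step G P z s)) \<le> Suc k \<and>
    (\<forall>c\<in>set (snd (cluster_step G P z s)). fst c \<in> set P \<and> set (snd c) \<subseteq> set P \<and> length (snd c) \<le> length P)"
proof (cases "fst s = []")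
  case True
  then show ?thesis using assms by (simp add: cluster_step_def)
next
  case False
  have "argmax z (fst s) \<in> set P" using argmax(1)[OF False] assms(2) by blast
  moreover have "length (filter Q (fst s)) \<le> length P" for Q
    using length_filter_le[of Q "fst s"] assms(1) by linarith
  ultimately show ?thesis using False assms by (auto simp: cluster_step_def)
qed

lemma clusters_sizes:
  "length (clusters G P z) \<le> length P"
  "c \<in> set (clusters G P z) \<Longrightarrow> length (snd c) \<le> length P"
proof -
  let ?s = "\<lambda>xs :: nat list. foldl (\<lambda>s _. cluster_step G P z s) (P, []) xs"
  have "length (fst (?s xs)) \<le> length P \<and> set (fst (?s xs)) \<subseteq> set P \<and> length (snd (?s xs)) \<le> length xs \<and>
    (\<forall>c\<in>set (snd (?s xs)). fst c \<in> set P \<and> set (snd c) \<subseteq> set P \<and> length (snd c) \<le> length P)" for xs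
  proof (induction xs rule: rev_induct)
    case (snoc a xs)
    then show ?case using cluster_step_sizes[of "?s xs" P "length xs" G z] by simp
  qed simp
  from this[of P] show "length (clusters G P z) \<le> length P"
    "c \<in> set (clusters G P z) \<Longrightarrow> length (snd c) \<le> length P"
    by (auto simp: clusters_def)
qed

lemma size_of_sublist:
  assumes "length ys \<le> n" "set ys \<subseteq> set xs"
  shows "size_of ys \<le> 1 + n * (1 + size_of (xs :: 'a::enc list))"
proof -
  have "size_of ys \<le> 1 + length ys * (1 + size_of xs)"
    using size_of_member assms(2) by (intro size_of_list_le) blast
  also have "\<dots> \<le> 1 + n * (1 + size_of xs)" using assms(1) by (intro add_left_mono mult_right_mono) simp_all
  finally show ?thesis .
qed

lemma poly_time_clusters [poly_time_intros]:
  assumes "poly_time D G" "poly_time D P" "poly_time D z"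
  shows "poly_time D (\<lambda>x. clusters (G x) (P x) (z x))"
proof (rule poly_time_lift3[OF _ assms UNIV_I])
  let ?P = "\<lambda>x :: bool list list \<times> nat list \<times> nat list. fst (snd x)"
  let ?J = "\<lambda>x k s. length (fst s) \<le> length (?P x) \<and> set (fst s) \<subseteq> set (?P x) \<and> length (snd s) \<le> k \<and>
    (\<forall>c\<in>set (snd s). fst c \<in> set (?P x) \<and> set (snd c) \<subseteq> set (?P x) \<and> length (snd c) \<le> length (?P x))"
  define b where "b x = 1 + length (?P x) * (1 + size_of (?P x))" for x
  have b: "poly_bounded UNIV b"
    unfolding b_def
    by (intro poly_bounded_intros poly_time_size poly_time_intros
        poly_bounded_mono[OF _ length_le_size_of, of UNIV ?P])
  have "poly_time UNIV (\<lambda>x. foldl (\<lambda>s _. cluster_step (fst x) (?P x) (snd (snd x)) s) (?P x, []) (?P x))"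
  proof (rule poly_time_foldl[where J = ?J and B = "\<lambda>x. 1 + b x + (1 + size_of (?P x) * (2 + size_of (?P x) + b x))"])
    fix x k s assume k: "k \<le> length (?P x)" and J: "?J x k s"
    have fst: "size_of (fst s) \<le> b x" unfolding b_def using J by (intro size_of_sublist) auto
    have "size_of (snd s) \<le> 1 + length (snd s) * (1 + (1 + size_of (?P x) + b x))"
    proof (rule size_of_list_le)
      fix c assume c: "c \<in> set (snd s)"
      have "size_of (snd c) \<le> b x" unfolding b_def using J c by (intro size_of_sublist) auto
      moreover have "size_of (fst c) \<le> size_of (?P x)" using J c by (intro size_of_member) auto
      ultimately show "size_of c \<le> 1 + size_of (?P x) + b x" by simp
    qed
    also have "\<dots> \<le> 1 + size_of (?P x) * (2 + size_of (?P x) + b x)"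
      using J k length_le_size_of[of "?P x"] by (intro add_left_mono mult_mono) auto
    finally show "size_of s \<le> 1 + b x + (1 + size_of (?P x) * (2 + size_of (?P x) + b x))"
      using fst by simp
  next
    fix x k s assume "?J x k s"
    then show "?J x (Suc k) (cluster_step (fst x) (?P x) (snd (snd x)) s)"
      by (intro cluster_step_sizes) auto
  next
    show "poly_bounded UNIV (\<lambda>x. 1 + b x + (1 + size_of (?P x) * (2 + size_of (?P x) + b x)))"
      by (intro poly_bounded_intros b poly_time_size poly_time_intros)
  qed (unfold cluster_step_def, (intro poly_time_intros | simp)+)
  then show "poly_time UNIV (\<lambda>p. clusters (fst p) (fst (snd p)) (snd (snd p)))"
    unfolding clusters_def by (intro poly_time_intros)
qed

lemma poly_time_load [poly_time_intros]:
  assumes "poly_time D r" "poly_time D S"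
  shows "poly_time D (\<lambda>x. load (r x) (S x))"
  by (rule poly_time_lift2[OF _ assms UNIV_I]) (unfold load_def, intro poly_time_intros)

lemma poly_time_dominates [poly_time_intros]:
  assumes "poly_time D W" "poly_time D s" "poly_time D t"
  shows "poly_time D (\<lambda>x. dominates (W x) (s x) (t x))"
  by (rule poly_time_lift3[OF _ assms UNIV_I]) (unfold dominates_def, intro poly_time_intros)

lemma poly_time_prune [poly_time_intros]:
  assumes "poly_time D W" "poly_time D L"
  shows "poly_time D (\<lambda>x. prune (W x) (L x))"
proof (rule poly_time_lift2[OF _ assms UNIV_I])
  let ?L = "\<lambda>x :: nat list list \<times> (nat \<times> nat list) list. snd x"
  show "poly_time UNIV (\<lambda>x. prune (fst x) (?L x))"
    unfolding prune_def
  proof (rule poly_time_foldl[where J = "\<lambda>x k s. set s \<subseteq> set (?L x) \<and> length s \<le> k"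
        and B = "\<lambda>x. 1 + size_of (?L x) * (1 + size_of (?L x))"])
    fix x k s assume "k \<le> length (?L x)" "set s \<subseteq> set (?L x) \<and> length s \<le> k"
    then show "size_of s \<le> 1 + size_of (?L x) * (1 + size_of (?L x))"
      using length_le_size_of[of "?L x"] by (intro size_of_sublist) auto
  next
    fix x k s assume k: "k < length (?L x)" "set s \<subseteq> set (?L x) \<and> length s \<le> k"
    then show "set (insert_state (fst x) s (?L x ! k)) \<subseteq> set (?L x) \<and>
        length (insert_state (fst x) s (?L x ! k)) \<le> Suc k"
      using length_filter_le[of "\<lambda>t. \<not> dominates (fst x) (?L x ! k) t" s]
      by (auto simp: insert_state_def simp del: length_filter_le)
  qed (unfold insert_state_def, (intro poly_time_intros poly_bounded_intros poly_time_size | simp)+)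
qed

lemma poly_time_extend_states [poly_time_intros]:
  assumes "poly_time D G" "poly_time D P" "poly_time D L" "poly_time D c"
  shows "poly_time D (\<lambda>x. extend_states (G x) (P x) (L x) (c x))"
  by (rule poly_time_lift4[OF _ assms UNIV_I]) (unfold extend_states_def, intro poly_time_intros)

definition bounded_weights :: "nat \<Rightarrow> nat poly \<Rightarrow> nat list \<Rightarrow> nat list list \<Rightarrow> bool" where
  "bounded_weights d p P W \<longleftrightarrow> length W = d \<and>
     (\<exists>j. \<forall>i<d. i \<noteq> j \<longrightarrow> (\<forall>u\<in>set P. nth_default 0 (W ! i) u \<le> poly p (length P)))"

lemma gain_le: "(\<And>c. c \<in> set cs \<Longrightarrow> length (snd c) \<le> n) \<Longrightarrow> gain G cs T \<le> length cs * n"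
  unfolding gain_def by (induction cs) (auto simp: add_mono trans_le_add2)

lemma load_le: "(\<And>u. u \<in> set S \<Longrightarrow> nth_default 0 r u \<le> m) \<Longrightarrow> load r S \<le> length S * m"
  by (induction S) (auto simp: add_mono)

lemma pareto_states: "pareto W (states G P W cs)"
  by (cases cs rule: rev_cases) (auto simp: states_snoc pareto_prune, simp add: states_def pareto_def)

lemma size_of_states:
  assumes W: "bounded_weights d p P W" and cs: "length cs \<le> length P"
    "\<And>c. c \<in> set cs \<Longrightarrow> length (snd c) \<le> length P"
  defines "n \<equiv> length P"
  shows "size_of (states G P W cs) \<le>
    1 + ((n * n + 1) * (n * poly p n + 1) ^ d) * (1 + (3 + n * n + n * (1 + size_of P)))"
proof -
  let ?L = "states G P W cs"
  obtain j where j: "\<And>i u. i < d \<Longrightarrow> i \<noteq> j \<Longrightarrow> u \<in> set P \<Longrightarrow> nth_default 0 (W ! i) u \<le> poly p n"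
    using W unfolding bounded_weights_def n_def by blast
  have state: "set (snd s) \<subseteq> set P" "length (snd s) \<le> n" "fst s \<le> n * n" if "s \<in> set ?L" for s
  proof -
    have "gain G cs (set (snd s)) \<le> length cs * n" by (rule gain_le) (simp add: cs(2) n_def)
    also have "\<dots> \<le> n * n" using cs(1) by (simp add: n_def)
    finally show "set (snd s) \<subseteq> set P" "length (snd s) \<le> n" "fst s \<le> n * n"
      using states_sound[OF that] cs(1) by (auto simp: n_def)
  qed
  have "length ?L \<le> (n * n + 1) * (n * poly p n + 1) ^ length W"
  proof (rule length_pareto[OF pareto_states])
    fix s i assume s: "s \<in> set ?L" and i: "i < length W" "i \<noteq> j"
    have "load (W ! i) (snd s) \<le> length (snd s) * poly p n"
      using state(1)[OF s] i j W by (intro load_le) (auto simp: bounded_weights_def)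
    also have "\<dots> \<le> n * poly p n" using state(2)[OF s] by simp
    finally show "load (W ! i) (snd s) \<le> n * poly p n" .
  qed (rule state(3))
  moreover have "size_of ?L \<le> 1 + length ?L * (1 + (3 + n * n + n * (1 + size_of P)))"
  proof (rule size_of_list_le)
    fix s assume s: "s \<in> set ?L"
    have "size_of (fst s) \<le> 1 + n * n" using size_of_nat[of "fst s"] state(3)[OF s] by linarith
    moreover have "size_of (snd s) \<le> 1 + n * (1 + size_of P)"
      using state(1,2)[OF s] by (intro size_of_sublist)
    ultimately show "size_of s \<le> 3 + n * n + n * (1 + size_of P)" by simp
  qed
  moreover have "length W = d" using W by (simp add: bounded_weights_def)
  ultimately show ?thesis by (meson add_left_mono mult_right_mono order_trans zero_le)
qed

lemma poly_bounded_length: "poly_time D xs \<Longrightarrow> poly_bounded D (\<lambda>x. length (xs x))"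
  by (rule poly_bounded_mono[OF poly_time_size length_le_size_of])

lemma poly_time_states:
  "poly_time {(G, P, W, cs). bounded_weights d p P W \<and> length cs \<le> length P \<and>
       (\<forall>c\<in>set cs. length (snd c) \<le> length P)}
     (\<lambda>x. states (fst x) (fst (snd x)) (fst (snd (snd x))) (snd (snd (snd x))))"
  (is "poly_time ?E _")
proof -
  let ?G = "\<lambda>x :: bool list list \<times> nat list \<times> nat list list \<times> (nat \<times> nat list) list. fst x"
  let ?P = "\<lambda>x :: bool list list \<times> nat list \<times> nat list list \<times> (nat \<times> nat list) list. fst (snd x)"
  let ?W = "\<lambda>x :: bool list list \<times> nat list \<times> nat list list \<times> (nat \<times> nat list) list. fst (snd (snd x))"
  let ?cs = "\<lambda>x :: bool list list \<times> nat list \<times> nat list list \<times> (nat \<times> nat list) list. snd (snd (snd x))"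
  let ?n = "\<lambda>x. length (?P x)"
  let ?B = "\<lambda>x. 1 + ((?n x * ?n x + 1) * (?n x * poly p (?n x) + 1) ^ d) *
     (1 + (3 + ?n x * ?n x + ?n x * (1 + size_of (?P x))))"
  have P: "poly_time ?E ?P" by (intro poly_time_intros)
  have "poly_time ?E (\<lambda>x. foldl (\<lambda>L c. prune (?W x) (extend_states (?G x) (?P x) L c)) [(0, [])] (?cs x))"
  proof (rule poly_time_foldl[where J = "\<lambda>x k L. L = states (?G x) (?P x) (?W x) (take k (?cs x))" and B = ?B])
    show "poly_bounded ?E ?B"
      by (intro poly_bounded_intros poly_bounded_length poly_time_size P)
    fix x k L assume x: "x \<in> ?E" and k: "k \<le> length (?cs x)"
      and L: "L = states (?G x) (?P x) (?W x) (take k (?cs x))"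
    have x': "bounded_weights d p (?P x) (?W x)" "length (?cs x) \<le> length (?P x)"
      "\<And>c. c \<in> set (?cs x) \<Longrightarrow> length (snd c) \<le> length (?P x)" using x by (simp_all add: case_prod_beta)
    show "size_of L \<le> ?B x"
      unfolding L by (rule size_of_states[OF x'(1)]) (use x'(2) in simp, rule x'(3), erule in_set_takeD)
  qed (intro poly_time_intros | simp add: states_snoc take_Suc_conv_app_nth | simp add: states_def)+
  then show ?thesis by (simp add: states_def)
qed

definition selection_args where
  "selection_args d p = {(G, P, W, B, m, cs). bounded_weights d p P W \<and> length cs \<le> length P \<and>
       (\<forall>c\<in>set cs. length (snd c) \<le> length P)}"

lemma poly_time_selections:
  "poly_time (selection_args d p)
     (\<lambda>x. selections (fst x) (fst (snd x)) (fst (snd (snd x))) (fst (snd (snd (snd x))))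
       (fst (snd (snd (snd (snd x))))) (snd (snd (snd (snd (snd x))))))"
proof -
  have "poly_time (selection_args d p) (\<lambda>x. states (fst x) (fst (snd x)) (fst (snd (snd x)))
     (snd (snd (snd (snd (snd x))))))"
    by (rule poly_time_lift4[OF poly_time_states[of d p]]) ((intro poly_time_intros)+, simp add: selection_args_def case_prod_beta)
  then show ?thesis unfolding selections_def by (intro poly_time_intros)
qed

lemma poly_time_search:
  "poly_time {(G, P, W, B, m). bounded_weights d p P W}
     (\<lambda>x. search (fst x) (fst (snd x)) (fst (snd (snd x))) (fst (snd (snd (snd x))))
       (snd (snd (snd (snd x)))))"
  (is "poly_time ?E _")
proof -
  let ?G = "\<lambda>x :: bool list list \<times> nat list \<times> nat list list \<times> nat list \<times> nat. fst x"
  let ?P = "\<lambda>x :: bool list list \<times> nat list \<times> nat list list \<times> nat list \<times> nat. fst (snd x)"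
  let ?W = "\<lambda>x :: bool list list \<times> nat list \<times> nat list list \<times> nat list \<times> nat. fst (snd (snd x))"
  let ?B = "\<lambda>x :: bool list list \<times> nat list \<times> nat list list \<times> nat list \<times> nat. fst (snd (snd (snd x)))"
  let ?m = "\<lambda>x :: bool list list \<times> nat list \<times> nat list list \<times> nat list \<times> nat. snd (snd (snd (snd x)))"
  let ?J = "\<lambda>x k z. length z \<le> length (?P x) \<and> (\<forall>e::nat\<in>set z. e \<le> k)"
  have sel: "poly_time D (\<lambda>x. selections (?G (a x)) (?P (a x)) (?W (a x)) (?B (a x)) (?m (a x))
      (clusters (?G (a x)) (?P (a x)) (z x)))"
    if "poly_time D a" "poly_time D z" "\<And>x. x \<in> D \<Longrightarrow> a x \<in> ?E" for D :: "'a::enc set" and a z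
    by (rule poly_time_lift6[OF poly_time_selections[of d p]])
      ((intro poly_time_intros that(1,2))+, use that(3) in \<open>simp add: selection_args_def case_prod_beta clusters_sizes\<close>)
  have rounds: "poly_time ?E (\<lambda>x. rounds (?P x))"
    unfolding rounds_def by (intro poly_time_intros)
  let ?z = "\<lambda>x. foldl (\<lambda>z _. perceptron_step (?G x) (?P x) (?W x) (?B x) (?m x) z) (map (\<lambda>u. 0) (?P x)) (rounds (?P x))"
  have "poly_time ?E ?z"
  proof (rule poly_time_foldl[where J = ?J
        and B = "\<lambda>x. 1 + length (?P x) * (1 + (1 + length (rounds (?P x))))"])
    let ?D = "{(x, z, y). x \<in> ?E \<and> (\<exists>k<length (rounds (?P x)). ?J x k z \<and> y = rounds (?P x) ! k)}"
    have "poly_time ?D (\<lambda>p. selections (?G (fst p)) (?P (fst p)) (?W (fst p)) (?B (fst p)) (?m (fst p))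
      (clusters (?G (fst p)) (?P (fst p)) (fst (snd p))))"
      by (rule sel) ((intro poly_time_intros)+, auto)
    then show "poly_time ?D (\<lambda>p. perceptron_step (?G (fst p)) (?P (fst p)) (?W (fst p)) (?B (fst p)) (?m (fst p)) (fst (snd p)))"
      unfolding perceptron_step_def by (intro poly_time_intros)
  next
    fix x k z assume k: "k \<le> length (rounds (?P x))" and J: "?J x k z"
    have "size_of z \<le> 1 + length z * (1 + (1 + length (rounds (?P x))))"
    proof (rule size_of_list_le)
      fix e assume "e \<in> set z"
      then show "size_of e \<le> 1 + length (rounds (?P x))" using size_of_nat[of e] J k by force
    qed
    also have "\<dots> \<le> 1 + length (?P x) * (1 + (1 + length (rounds (?P x))))"
      using J by (intro add_left_mono mult_right_mono) auto
    finally show "size_of z \<le> 1 + length (?P x) * (1 + (1 + length (rounds (?P x))))" .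
  next
    fix x k and z :: "nat list" assume J: "?J x k z"
    then have "nth_default 0 z u \<le> k" for u by (auto simp: nth_default_def)
    then show "?J x (Suc k) (perceptron_step (?G x) (?P x) (?W x) (?B x) (?m x) z)"
      using J by (auto simp: perceptron_step_def le_SucI diff_le_self intro: le_trans[OF diff_le_self] le_SucI)
  next
    show "poly_bounded ?E (\<lambda>x. 1 + length (?P x) * (1 + (1 + length (rounds (?P x)))))"
      by (intro poly_bounded_intros poly_bounded_length rounds) (intro poly_time_intros)
  qed (intro poly_time_intros rounds | simp)+
  then show ?thesis unfolding search_def by (rule sel[OF poly_time_id]) auto
qed

section \<open>The approximation algorithm\<close>

definition rat_pair :: "rat \<Rightarrow> nat \<times> nat" where
  "rat_pair r = (nat (fst (quotient_of r)), nat (snd (quotient_of r)))"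

definition pair_le :: "nat \<times> nat \<Rightarrow> nat \<times> nat \<Rightarrow> bool" where
  "pair_le e f \<longleftrightarrow> fst e * snd f \<le> fst f * snd e"

lemma pair_le_rat_pair:
  assumes "0 \<le> a" "0 \<le> b"
  shows "pair_le (rat_pair a) (rat_pair b) \<longleftrightarrow> a \<le> b"
proof -
  obtain p q p' q' where q: "quotient_of a = (p, q)" "quotient_of b = (p', q')"
    by (metis surj_pair)
  have pos: "0 < q" "0 < q'" using quotient_of_denom_pos[OF q(1)] quotient_of_denom_pos[OF q(2)] by auto
  have eq: "a = of_int p / of_int q" "b = of_int p' / of_int q'"
    using quotient_of_div[OF q(1)] quotient_of_div[OF q(2)] by auto
  have nonneg: "0 \<le> p" "0 \<le> p'" using assms pos unfolding eq by (auto simp: zero_le_divide_iff)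
  have "a \<le> b \<longleftrightarrow> (of_int (p * q') :: rat) \<le> of_int (p' * q)"
    unfolding eq using pos by (simp add: divide_simps)
  also have "\<dots> \<longleftrightarrow> p * q' \<le> p' * q" by (simp only: of_int_le_iff)
  also have "\<dots> \<longleftrightarrow> nat (p * q') \<le> nat (p' * q)"
    using pos nonneg by (intro nat_le_eq_zle[symmetric] disjI2) simp
  also have "\<dots> \<longleftrightarrow> pair_le (rat_pair a) (rat_pair b)"
    using pos nonneg by (simp add: pair_le_def rat_pair_def q nat_mult_distrib)
  finally show ?thesis ..
qed

type_synonym encoded_instance =
  "nat \<times> (nat \<times> nat) list list \<times> nat \<times> nat list list \<times> nat list \<times> nat \<times> nat"

definition instance_data :: "rmkc \<Rightarrow> encoded_instance" where
  "instance_data I =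
     (npoints I,
      map (\<lambda>u. map (\<lambda>v. rat_pair (distance I u v)) [0..<npoints I]) [0..<npoints I],
      nweights I,
      map (\<lambda>i. map (\<lambda>v. weight I i v) [0..<npoints I]) [0..<nweights I],
      map (\<lambda>i. budget I i) [0..<nweights I],
      quota I, 0)"

lemma enc_map: "enc (map f xs) = encode_list (\<lambda>x. enc (f x)) xs"
  by (induction xs) auto

lemma enc_instance_data: "enc (instance_data I) = encode_rmkc I"
  by (simp add: instance_data_def encode_rmkc_def enc_map rat_pair_def encode_rat_def split_beta)

definition search_radius :: "encoded_instance \<Rightarrow> nat \<times> nat \<Rightarrow> nat list list" where
  "search_radius x r = search (map (\<lambda>es. map (\<lambda>e. pair_le e r) es) (fst (snd x)))
     [0..<length (fst (snd x))] (fst (snd (snd (snd x)))) (fst (snd (snd (snd (snd x)))))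
     (fst (snd (snd (snd (snd (snd x))))))"

definition radii :: "encoded_instance \<Rightarrow> (nat \<times> nat) list" where
  "radii x = filter (\<lambda>r. search_radius x r \<noteq> []) (concat (map (\<lambda>es. es) (fst (snd x))))"

definition least_radii :: "encoded_instance \<Rightarrow> (nat \<times> nat) list" where
  "least_radii x = filter (\<lambda>r. \<forall>r'\<in>set (radii x). pair_le r r') (radii x)"

definition algorithm :: "encoded_instance \<Rightarrow> nat list" where
  "algorithm x = (if least_radii x = [] then []
     else nth_default [] (search_radius x (nth_default (0, 0) (least_radii x) 0)) 0)"

lemma bounded_weights_instance_data:
  assumes "I \<in> rmkc_class d p"
  shows "bounded_weights d p [0..<npoints I] (fst (snd (snd (snd (instance_data I)))))"
proof -
  obtain j where "\<And>i v. i < d \<Longrightarrow> i \<noteq> j \<Longrightarrow> v < npoints I \<Longrightarrow> weight I i v \<le> poly p (npoints I)"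
    using assms unfolding rmkc_class_def weight_bounded_by_def by auto
  then show ?thesis
    using assms by (auto simp: bounded_weights_def instance_data_def rmkc_class_def nth_default_def intro!: exI[of _ j])
qed

lemma poly_time_algorithm: "poly_time (instance_data ` rmkc_class d p) algorithm"
proof -
  let ?E = "instance_data ` rmkc_class d p"
  have search: "poly_time D (\<lambda>y. search_radius (a y) (r y))"
    if a: "poly_time D a" and r: "poly_time D r" and E: "\<And>y. y \<in> D \<Longrightarrow> a y \<in> ?E" for D :: "'a::enc set" and a r
    unfolding search_radius_def
  proof (rule poly_time_lift5[OF poly_time_search[of d p]])
    fix y assume "y \<in> D"
    then obtain I where I: "I \<in> rmkc_class d p" "a y = instance_data I" using E by blast
    have "length (fst (snd (a y))) = npoints I" by (simp add: I(2) instance_data_def)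
    then show "(map (\<lambda>es. map (\<lambda>e. pair_le e (r y)) es) (fst (snd (a y))), [0..<length (fst (snd (a y)))],
        fst (snd (snd (snd (a y)))), fst (snd (snd (snd (snd (a y))))), fst (snd (snd (snd (snd (snd (a y)))))))
        \<in> {(G, P, W, B, m). bounded_weights d p P W}"
      using bounded_weights_instance_data[OF I(1)] by (simp add: I(2))
  next
    have "poly_time {(y, es). y \<in> D \<and> es \<in> set (fst (snd (a y)))} (\<lambda>q. r (fst q))"
      by (rule poly_time_comp[OF r]) (intro poly_time_intros, auto)
    then have "poly_time {(q, e). q \<in> {(y, es). y \<in> D \<and> es \<in> set (fst (snd (a y)))} \<and> e \<in> set (snd q)}
      (\<lambda>q. r (fst (fst q)))"
      by (rule poly_time_comp) (intro poly_time_intros, auto)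
    then show "poly_time D (\<lambda>y. map (\<lambda>es. map (\<lambda>e. pair_le e (r y)) es) (fst (snd (a y))))"
      unfolding pair_le_def by (intro poly_time_intros a)
  qed (intro poly_time_intros a)+
  have radii: "poly_time ?E radii"
    unfolding radii_def by (intro poly_time_intros search) auto
  have least: "poly_time ?E least_radii"
  proof -
    have "poly_time {(x, r). x \<in> ?E \<and> r \<in> set (radii x)} (\<lambda>q. radii (fst q))"
      by (rule poly_time_comp[OF radii]) (intro poly_time_intros, auto)
    then show ?thesis unfolding least_radii_def pair_le_def by (intro poly_time_intros radii)
  qed
  show ?thesis
    unfolding algorithm_def by (intro poly_time_intros least search)
qed

locale rmkc_instance =
  fixes I :: rmkc
  assumes valid: "valid_rmkc I"
begin

abbreviation "n \<equiv> npoints I"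
abbreviation "x \<equiv> instance_data I"

interpretation Metric_space "points I" "\<lambda>u v. real_of_rat (distance I u v)"
  using valid by (simp add: valid_rmkc_def)

lemma distance_nonneg: "0 \<le> distance I u v"
  using nonneg[of u v] by simp

lemma distance_refl: "u < n \<Longrightarrow> distance I u u = 0"
  using mdist_zero[of u] by (metis lessThan_iff of_rat_eq_0_iff)

lemma distance_commute: "distance I u v = distance I v u"
  using commute[of u v] by simp

lemma distance_triangle:
  assumes "u < n" "v < n" "w < n"
  shows "distance I u w \<le> distance I u v + distance I v w"
proof -
  have "real_of_rat (distance I u w) \<le> real_of_rat (distance I u v) + real_of_rat (distance I v w)"
    using triangle[of u v w] assms by simp
  then show ?thesis by (simp flip: of_rat_add add: of_rat_less_eq)
qed

definition radius_graph :: "rat \<Rightarrow> bool list list" where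
  "radius_graph \<rho> = map (\<lambda>es. map (\<lambda>e. pair_le e (rat_pair \<rho>)) es) (fst (snd x))"

lemma adj_radius_graph:
  "u < n \<Longrightarrow> v < n \<Longrightarrow> 0 \<le> \<rho> \<Longrightarrow> adj (radius_graph \<rho>) u v \<longleftrightarrow> distance I u v \<le> \<rho>"
  by (simp add: adj_def radius_graph_def instance_data_def nth_default_nth pair_le_rat_pair distance_nonneg)

lemma cover_graph: "0 \<le> \<rho> \<Longrightarrow> cover_graph (radius_graph \<rho>) [0..<n]"
  by unfold_locales (simp_all add: adj_radius_graph distance_refl)

lemma search_radius_eq:
  "search_radius x (rat_pair \<rho>) = search (radius_graph \<rho>) [0..<n] (fst (snd (snd (snd x))))
     (fst (snd (snd (snd (snd x))))) (quota I)"
  by (simp add: search_radius_def radius_graph_def) (simp add: instance_data_def)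

lemma within_budget_iff:
  assumes "S \<subseteq> points I"
  shows "within_budget (fst (snd (snd (snd x)))) (fst (snd (snd (snd (snd x))))) S \<longleftrightarrow> feasible I S"
proof -
  have "(\<Sum>u\<in>S. nth_default 0 (map (weight I i) [0..<n]) u) = (\<Sum>u\<in>S. weight I i u)" for i
    using assms by (intro sum.cong) (auto simp: nth_default_nth)
  then show ?thesis using assms
    by (simp add: within_budget_def feasible_def instance_data_def nth_default_nth)
qed

lemma search_radius_sound:
  assumes S: "S \<in> set (search_radius x (rat_pair \<rho>))" and "0 \<le> \<rho>"
  shows "feasible I (set S)"
    and "quota I \<le> card {v \<in> points I. dist_to_set I v (set S) \<le> 3 * ennreal (real_of_rat \<rho>)}"
proof -
  interpret cover_graph "radius_graph \<rho>" "[0..<n]" by (rule cover_graph) fact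
  note sound = search_sound[OF S[unfolded search_radius_eq]]
  have S: "set S \<subseteq> points I" using sound(1) by auto
  then show "feasible I (set S)" using sound(2) within_budget_iff by blast
  have "dist_to_set I u (set S) \<le> 3 * ennreal (real_of_rat \<rho>)"
    if u: "u < n" and v: "v \<in> covered (radius_graph \<rho>) [0..<n] (set S)"
      and near: "near (radius_graph \<rho>) [0..<n] u v" for u v
  proof -
    obtain s where s: "v < n" "s \<in> set S" "s < n" "distance I v s \<le> \<rho>"
      using v S adj_radius_graph \<open>0 \<le> \<rho>\<close> by (fastforce simp: covered_def)
    obtain w where w: "w < n" "distance I u w \<le> \<rho>" "distance I v w \<le> \<rho>"
      using near u s(1) adj_radius_graph \<open>0 \<le> \<rho>\<close> by (auto simp: near_def)
    have "distance I u s \<le> distance I u w + distance I w s" using u w(1) s(3) by (rule distance_triangle)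
    also have "distance I w s \<le> distance I w v + distance I v s" using w(1) s(1,3) by (rule distance_triangle)
    finally have "distance I u s \<le> 3 * \<rho>" using s(4) w(2,3) distance_commute[of v w] by simp
    then have "real_of_rat (distance I u s) \<le> real_of_rat (3 * \<rho>)" by (simp only: of_rat_less_eq)
    then have "ennreal (real_of_rat (distance I u s)) \<le> ennreal (3 * real_of_rat \<rho>)"
      by (intro ennreal_leI) (simp add: of_rat_mult)
    also have "\<dots> = 3 * ennreal (real_of_rat \<rho>)" using \<open>0 \<le> \<rho>\<close> by (simp add: ennreal_mult)
    finally show ?thesis unfolding dist_to_set_def using s(2) by (rule INF_lower2[rotated])
  qed
  then have "card {u \<in> set [0..<n]. \<exists>v\<in>covered (radius_graph \<rho>) [0..<n] (set S). near (radius_graph \<rho>) [0..<n] u v}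
      \<le> card {v \<in> points I. dist_to_set I v (set S) \<le> 3 * ennreal (real_of_rat \<rho>)}"
    by (intro card_mono) auto
  with sound(3) show "quota I \<le> card {v \<in> points I. dist_to_set I v (set S) \<le> 3 * ennreal (real_of_rat \<rho>)}"
    by (rule order_trans)
qed

lemma search_radius_complete:
  assumes "0 < n" and T: "feasible I T" and Q: "Q \<subseteq> points I" "card Q = quota I"
    and fin: "(SUP v\<in>Q. dist_to_set I v T) \<noteq> top"
  shows "\<exists>u<n. \<exists>v<n. search_radius x (rat_pair (distance I u v)) \<noteq> [] \<and>
    ennreal (real_of_rat (distance I u v)) \<le> (SUP v\<in>Q. dist_to_set I v T)"
proof -
  let ?sup = "SUP v\<in>Q. dist_to_set I v T"
  have TP: "T \<subseteq> points I" using T by (simp add: feasible_def)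
  then have "finite T" by (rule finite_subset) simp
  have "\<exists>u\<in>T. ennreal (real_of_rat (distance I v u)) \<le> ?sup" if "v \<in> Q" for v
  proof -
    let ?D = "(\<lambda>u. ennreal (real_of_rat (distance I v u))) ` T"
    have le: "dist_to_set I v T \<le> ?sup" using that by (rule SUP_upper)
    then have "T \<noteq> {}" using fin by (auto simp: dist_to_set_def top_unique)
    then have D: "finite ?D" "?D \<noteq> {}" using \<open>finite T\<close> by auto
    have "dist_to_set I v T \<in> ?D" using Min_in[OF D] by (simp only: Min_Inf[OF D] dist_to_set_def)
    then obtain u where "u \<in> T" "dist_to_set I v T = ennreal (real_of_rat (distance I v u))" by (rule imageE)
    then show ?thesis using le by auto
  qed
  then obtain f where f: "\<And>v. v \<in> Q \<Longrightarrow> f v \<in> T"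
    "\<And>v. v \<in> Q \<Longrightarrow> ennreal (real_of_rat (distance I v (f v))) \<le> ?sup" by metis
  let ?R = "insert 0 ((\<lambda>v. distance I v (f v)) ` Q)"
  have "finite Q" using Q(1) by (rule finite_subset) simp
  then have R: "finite ?R" "?R \<noteq> {}" by auto
  define \<rho> where "\<rho> = Max ?R"
  have \<rho>: "0 \<le> \<rho>" "\<And>v. v \<in> Q \<Longrightarrow> distance I v (f v) \<le> \<rho>"
    unfolding \<rho>_def using Max_ge[OF R(1)] by auto
  have "\<rho> \<in> ?R" unfolding \<rho>_def by (rule Max_in[OF R])
  then have "\<exists>u<n. \<exists>v<n. \<rho> = distance I u v \<and> ennreal (real_of_rat \<rho>) \<le> ?sup"
  proof
    assume "\<rho> = 0"
    then show ?thesis using \<open>0 < n\<close> distance_refl by force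
  next
    assume "\<rho> \<in> (\<lambda>v. distance I v (f v)) ` Q"
    then show ?thesis using f TP Q(1) by (smt (verit) imageE lessThan_iff subsetD)
  qed
  then obtain u v where uv: "u < n" "v < n" "\<rho> = distance I u v" "ennreal (real_of_rat \<rho>) \<le> ?sup" by blast
  have "Q \<subseteq> covered (radius_graph \<rho>) [0..<n] T"
  proof
    fix v assume v: "v \<in> Q"
    then have "v < n" "f v < n" "f v \<in> T" using Q(1) f(1) TP by auto
    then show "v \<in> covered (radius_graph \<rho>) [0..<n] T"
      using \<rho>(2)[OF v] \<rho>(1) adj_radius_graph[of v "f v" \<rho>] by (auto simp: covered_def)
  qed
  then have "quota I \<le> card (covered (radius_graph \<rho>) [0..<n] T)"
    unfolding Q(2)[symmetric] by (intro card_mono) (auto simp: covered_def)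
  then have "search_radius x (rat_pair \<rho>) \<noteq> []"
    unfolding search_radius_eq
    by (intro cover_graph.search_complete[OF cover_graph[OF \<rho>(1)] refl \<open>0 < n\<close>, of T])
      (use TP T within_budget_iff[OF TP] in auto)
  then show ?thesis using uv by blast
qed

lemma radii_iff:
  "r \<in> set (radii x) \<longleftrightarrow>
     (\<exists>u<n. \<exists>v<n. r = rat_pair (distance I u v)) \<and> search_radius x r \<noteq> []"
proof -
  have "r \<in> set (concat (map (\<lambda>es. es) (fst (snd x)))) \<longleftrightarrow> (\<exists>u<n. \<exists>v<n. r = rat_pair (distance I u v))"
    by (auto simp: instance_data_def intro!: bexI imageI) blast
  then show ?thesis unfolding radii_def by auto
qed

lemma least_radii_nonempty:
  assumes "radii x \<noteq> []"
  shows "least_radii x \<noteq> []"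
proof -
  let ?A = "{\<rho>. rat_pair \<rho> \<in> set (radii x) \<and> (\<exists>u<n. \<exists>v<n. \<rho> = distance I u v)}"
  have "?A \<subseteq> (\<lambda>(u, v). distance I u v) ` ({..<n} \<times> {..<n})" by auto
  then have fin: "finite ?A" by (rule finite_subset) simp
  have "hd (radii x) \<in> set (radii x)" using assms by simp
  then obtain u v where "u < n" "v < n" "rat_pair (distance I u v) \<in> set (radii x)"
    unfolding radii_iff by metis
  then have "distance I u v \<in> ?A" by auto
  then have "?A \<noteq> {}" by blast
  then have Min: "Min ?A \<in> ?A" by (rule Min_in[OF fin])
  have "pair_le (rat_pair (Min ?A)) r" if r: "r \<in> set (radii x)" for r
  proof -
    obtain u v where uv: "u < n" "v < n" "r = rat_pair (distance I u v)"
      using r unfolding radii_iff by blast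
    have "Min ?A \<le> distance I u v" using r uv by (intro Min_le[OF fin]) auto
    moreover have "0 \<le> Min ?A" using Min distance_nonneg by auto
    ultimately show ?thesis unfolding uv(3) using distance_nonneg by (simp add: pair_le_rat_pair)
  qed
  then have "rat_pair (Min ?A) \<in> set (least_radii x)" using Min by (auto simp: least_radii_def)
  then show ?thesis by auto
qed

lemma algorithm_correct: "approx_solution 3 I (set (algorithm x))"
proof (cases "least_radii x = []")
  case True
  then have "radii x = []" using least_radii_nonempty by blast
  have "quota I \<le> card {v \<in> points I. dist_to_set I v {} \<le> 3 * OPT I}"
  proof (cases "n = 0")
    case True
    then show ?thesis using valid by (simp add: valid_rmkc_def)
  next
    case False
    have "(SUP v\<in>Q. dist_to_set I v T) = top" if "feasible I T" "Q \<subseteq> points I" "card Q = quota I" for T Q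
      using search_radius_complete[OF _ that] False radii_iff \<open>radii x = []\<close> by fastforce
    then have "OPT I = top" unfolding OPT_def objective_def by (simp add: INF_eq_const)
    then show ?thesis using valid by (simp add: valid_rmkc_def ennreal_mult_top)
  qed
  then show ?thesis using True by (simp add: approx_solution_def algorithm_def feasible_def)
next
  case False
  let ?r = "nth_default (0, 0) (least_radii x) 0"
  have "?r \<in> set (least_radii x)" using False by (simp add: nth_default_nth)
  then have r: "?r \<in> set (radii x)" "\<And>r'. r' \<in> set (radii x) \<Longrightarrow> pair_le ?r r'"
    by (auto simp: least_radii_def)
  then obtain u v where uv: "u < n" "v < n" "?r = rat_pair (distance I u v)" "search_radius x ?r \<noteq> []"
    unfolding radii_iff by blast
  let ?\<rho> = "distance I u v"
  have "0 < n" using uv(1) by simp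
  have "algorithm x \<in> set (search_radius x (rat_pair ?\<rho>))"
    using False uv by (simp add: algorithm_def nth_default_nth)
  note sound = search_radius_sound[OF this distance_nonneg]
  have "ennreal (real_of_rat ?\<rho>) \<le> (SUP v\<in>Q. dist_to_set I v T)"
    if T: "feasible I T" and Q: "Q \<subseteq> points I" "card Q = quota I" for T Q
  proof (cases "(SUP v\<in>Q. dist_to_set I v T) = top")
    case fin: False
    obtain u' v' where u': "u' < n" "v' < n" "search_radius x (rat_pair (distance I u' v')) \<noteq> []"
      "ennreal (real_of_rat (distance I u' v')) \<le> (SUP v\<in>Q. dist_to_set I v T)"
      using search_radius_complete[OF \<open>0 < n\<close> T Q fin] by blast
    then have "rat_pair (distance I u' v') \<in> set (radii x)" unfolding radii_iff by blast
    then have "?\<rho> \<le> distance I u' v'"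
      using r(2) unfolding uv(3) by (metis pair_le_rat_pair distance_nonneg)
    then have "ennreal (real_of_rat ?\<rho>) \<le> ennreal (real_of_rat (distance I u' v'))"
      by (intro ennreal_leI) (simp add: of_rat_less_eq)
    then show ?thesis using u'(4) by (rule order_trans)
  qed (simp only: top_greatest)
  then have "ennreal (real_of_rat ?\<rho>) \<le> OPT I"
    unfolding OPT_def objective_def by (intro INF_greatest) auto
  then have "3 * ennreal (real_of_rat ?\<rho>) \<le> 3 * OPT I" by (rule mult_left_mono) simp
  then have "card {v \<in> points I. dist_to_set I v (set (algorithm x)) \<le> 3 * ennreal (real_of_rat ?\<rho>)}
    \<le> card {v \<in> points I. dist_to_set I v (set (algorithm x)) \<le> 3 * OPT I}"
    by (intro card_mono) (auto intro: order_trans)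
  then show ?thesis using sound by (simp add: approx_solution_def)
qed

end

theorem theorem4:
  fixes d :: nat and p :: "nat poly"
  shows "\<exists>A. poly_time_approx 3 (rmkc_class d p) A"
proof -
  obtain A g where A: "poly_bounded (instance_data ` rmkc_class d p) g"
    "\<And>x. x \<in> instance_data ` rmkc_class d p \<Longrightarrow> \<exists>t\<le>g x. runs A (enc x) (enc (algorithm x)) t"
    by (rule poly_timeE[OF poly_time_algorithm]) (rule that)
  obtain c k where ck: "\<And>x. x \<in> instance_data ` rmkc_class d p \<Longrightarrow> g x \<le> c * size_of x ^ k"
    using A(1) unfolding poly_bounded_def by blast
  have "\<exists>xs t. runs A (encode_rmkc I) (encode_list Num xs) t \<and>
      t \<le> poly (monom c k) (bits (encode_rmkc I)) \<and> approx_solution 3 I (set xs)"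
    if "I \<in> rmkc_class d p" for I
  proof -
    have x: "instance_data I \<in> instance_data ` rmkc_class d p" using that by simp
    obtain t where t: "t \<le> g (instance_data I)" "runs A (enc (instance_data I)) (enc (algorithm (instance_data I))) t"
      using A(2)[OF x] by blast
    have "enc (xs :: nat list) = encode_list Num xs" for xs by (induction xs) auto
    moreover have "t \<le> c * bits (encode_rmkc I) ^ k"
      using order_trans[OF t(1) ck[OF x]] by (simp only: enc_instance_data)
    moreover have "approx_solution 3 I (set (algorithm (instance_data I)))"
      using that by (intro rmkc_instance.algorithm_correct rmkc_instance.intro) (simp add: rmkc_class_def)
    ultimately show ?thesis using t(2) unfolding enc_instance_data poly_monom by metis
  qed
  then show ?thesis unfolding poly_time_approx_def by blast
qed

end
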